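(* Let $(M,J,g,F)$ be a nearly Kähler manifold with Hermitian scalar curvature $s^H$, third scalar curvature $s$ and Riemannian scalar curvature $s^g$. Then $$s^H \leq 2s \leq s^g,$$ with either equality holding precisely when $(J,g,F)$ is Kähler.
   Context: An almost Hermitian manifold $(M,J,g,F)$ (with $J$ an almost complex structure orthogonal for the Riemannian metric $g$, $F=g(J\cdot,\cdot)$) is nearly Kähler if $(D^g_XJ)Y+(D^g_YJ)X=0$ for all $X,Y$, where $D^g$ is the Levi-Civita connection. The Chern connection $\nabla$ is the unique connection on $TM$ with $\nabla g=0$, $\nabla J=0$ whose torsion $T_{XY}=\nabla_XY-\nabla_YX-[X,Y]$ satisfies $T_{JX,JY}=-T_{XY}$; its curvature is $R_{XY}=[\nabla_X,\nabla_Y]-\nabla_{[X,Y]}$. For a local $g$-orthonormal frame $(e_i)$ with $e_{2\alpha}=Je_{2\alpha-1}$: $s^H=2s^C$ with $s^C=-\frac14\sum_{i,j}g(R_{e_i,Je_i}e_j,Je_j)$, and $s=\frac12\sum_{i,j}g(R_{e_i,e_j}e_j,e_i)$. $s^g$ is the scalar curvature of $D^g$. *)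

theory Defs
  imports "HOL-Analysis.Analysis" "HOL-Library.Function_Algebras"
begin

text \<open>Only meant for open \<open>S\<close> and finite-dimensional domains, where continuity of all directional
  derivatives amounts to continuity of the derivative.\<close>

primrec Ck_on :: "nat \<Rightarrow> 'a::real_normed_vector set \<Rightarrow> ('a \<Rightarrow> 'b::real_normed_vector) \<Rightarrow> bool" where
  "Ck_on 0 S f \<longleftrightarrow> continuous_on S f"
| "Ck_on (Suc k) S f \<longleftrightarrow> (\<forall>x\<in>S. f differentiable (at x)) \<and>
     (\<forall>v. Ck_on k S (\<lambda>x. frechet_derivative f (at x) v))"

definition smooth_on :: "'a::real_normed_vector set \<Rightarrow> ('a \<Rightarrow> 'b::real_normed_vector) \<Rightarrow> bool" where
  "smooth_on S f \<longleftrightarrow> (\<forall>k. Ck_on k S f)"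

text \<open>The manifold is the whole type \<open>'m\<close>, modelled on the Euclidean space \<open>'e\<close> and given by an
  atlas of charts \<open>(U, \<phi>)\<close>, where only the values of \<open>\<phi>\<close> on \<open>U\<close> matter. The Hausdorff property
  and second countability are imposed by sort constraints on \<open>'m\<close>.\<close>

type_synonym ('m, 'e) atlas = "('m set \<times> ('m \<Rightarrow> 'e)) set"

definition smooth_atlas :: "('m::topological_space, 'e::euclidean_space) atlas \<Rightarrow> bool" where
  "smooth_atlas A \<longleftrightarrow>
     (\<Union>(U, \<phi>)\<in>A. U) = UNIV \<and>
     (\<forall>(U, \<phi>)\<in>A. open U \<and> open (\<phi> ` U) \<and> homeomorphism U (\<phi> ` U) \<phi> (inv_into U \<phi>)) \<and>
     (\<forall>(U, \<phi>)\<in>A. \<forall>(V, \<psi>)\<in>A. smooth_on (\<phi> ` (U \<inter> V)) (\<psi> \<circ> inv_into U \<phi>))"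

definition smooth_fun :: "('m::topological_space, 'e::euclidean_space) atlas \<Rightarrow> ('m \<Rightarrow> real) \<Rightarrow> bool" where
  "smooth_fun A f \<longleftrightarrow> (\<forall>(U, \<phi>)\<in>A. smooth_on (\<phi> ` U) (f \<circ> inv_into U \<phi>))"

text \<open>Tangent vectors at \<open>p\<close> are the derivations at \<open>p\<close> of the algebra of smooth functions,
  extended by \<open>0\<close> to non-smooth functions so that equality of tangent vectors is equality in HOL.
  Sums, differences, zero and products of functions, tangent vectors and vector fields are
  the pointwise ones of \<open>Function_Algebras\<close>.\<close>

type_synonym 'm tvec = "('m \<Rightarrow> real) \<Rightarrow> real"

type_synonym 'm vfield = "'m \<Rightarrow> 'm tvec"

definition tangent_space :: "('m::topological_space, 'e::euclidean_space) atlas \<Rightarrow> 'm \<Rightarrow> 'm tvec set" where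
  "tangent_space A p = {v.
     (\<forall>f. \<not> smooth_fun A f \<longrightarrow> v f = 0) \<and>
     (\<forall>f h. smooth_fun A f \<longrightarrow> smooth_fun A h \<longrightarrow>
        v (f + h) = v f + v h \<and> v (f * h) = f p * v h + h p * v f) \<and>
     (\<forall>f c. smooth_fun A f \<longrightarrow> v (\<lambda>x. c * f x) = c * v f)}"

definition vector_fields :: "('m::topological_space, 'e::euclidean_space) atlas \<Rightarrow> 'm vfield set" where
  "vector_fields A = {X. (\<forall>p. X p \<in> tangent_space A p) \<and>
     (\<forall>f. smooth_fun A f \<longrightarrow> smooth_fun A (\<lambda>p. X p f))}"

definition scale_tvec :: "real \<Rightarrow> 'm tvec \<Rightarrow> 'm tvec" where
  "scale_tvec c v = (\<lambda>f. c * v f)"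

definition scale_field :: "('m \<Rightarrow> real) \<Rightarrow> 'm vfield \<Rightarrow> 'm vfield" where
  "scale_field h X = (\<lambda>p. scale_tvec (h p) (X p))"

definition deriv_along :: "'m vfield \<Rightarrow> ('m \<Rightarrow> real) \<Rightarrow> 'm \<Rightarrow> real" where
  "deriv_along X f = (\<lambda>p. X p f)"

definition lie_bracket :: "'m vfield \<Rightarrow> 'm vfield \<Rightarrow> 'm vfield" where
  "lie_bracket X Y = (\<lambda>p f. X p (deriv_along Y f) - Y p (deriv_along X f))"

type_synonym 'm metric_tensor = "'m \<Rightarrow> 'm tvec \<Rightarrow> 'm tvec \<Rightarrow> real"

type_synonym 'm endo = "'m \<Rightarrow> 'm tvec \<Rightarrow> 'm tvec"

definition metric_app :: "'m metric_tensor \<Rightarrow> 'm vfield \<Rightarrow> 'm vfield \<Rightarrow> 'm \<Rightarrow> real" where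
  "metric_app g X Y = (\<lambda>p. g p (X p) (Y p))"

definition endo_app :: "'m endo \<Rightarrow> 'm vfield \<Rightarrow> 'm vfield" where
  "endo_app J X = (\<lambda>p. J p (X p))"

definition riemannian_metric ::
  "('m::topological_space, 'e::euclidean_space) atlas \<Rightarrow> 'm metric_tensor \<Rightarrow> bool" where
  "riemannian_metric A g \<longleftrightarrow>
     (\<forall>p. \<forall>u\<in>tangent_space A p. \<forall>v\<in>tangent_space A p.
        g p u v = g p v u \<and>
        (\<forall>w\<in>tangent_space A p. g p (u + v) w = g p u w + g p v w) \<and>
        (\<forall>c. g p (scale_tvec c u) v = c * g p u v) \<and>
        (u \<noteq> 0 \<longrightarrow> g p u u > 0)) \<and>
     (\<forall>X\<in>vector_fields A. \<forall>Y\<in>vector_fields A. smooth_fun A (metric_app g X Y))"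

definition almost_complex_structure ::
  "('m::topological_space, 'e::euclidean_space) atlas \<Rightarrow> 'm endo \<Rightarrow> bool" where
  "almost_complex_structure A J \<longleftrightarrow>
     (\<forall>p. \<forall>u\<in>tangent_space A p.
        J p u \<in> tangent_space A p \<and>
        (\<forall>v\<in>tangent_space A p. J p (u + v) = J p u + J p v) \<and>
        (\<forall>c. J p (scale_tvec c u) = scale_tvec c (J p u)) \<and>
        J p (J p u) = - u) \<and>
     (\<forall>X\<in>vector_fields A. endo_app J X \<in> vector_fields A)"

definition almost_hermitian ::
  "('m::topological_space, 'e::euclidean_space) atlas \<Rightarrow> 'm endo \<Rightarrow> 'm metric_tensor \<Rightarrow> bool" where
  "almost_hermitian A J g \<longleftrightarrow>
     smooth_atlas A \<and> almost_complex_structure A J \<and> riemannian_metric A g \<and>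
     (\<forall>p. \<forall>u\<in>tangent_space A p. \<forall>v\<in>tangent_space A p. g p (J p u) (J p v) = g p u v)"

definition fundamental_form :: "'m endo \<Rightarrow> 'm metric_tensor \<Rightarrow> 'm vfield \<Rightarrow> 'm vfield \<Rightarrow> 'm \<Rightarrow> real" where
  "fundamental_form J g X Y = metric_app g (endo_app J X) Y"

definition exterior_deriv2 ::
  "('m vfield \<Rightarrow> 'm vfield \<Rightarrow> 'm \<Rightarrow> real) \<Rightarrow> 'm vfield \<Rightarrow> 'm vfield \<Rightarrow> 'm vfield \<Rightarrow> 'm \<Rightarrow> real" where
  "exterior_deriv2 \<omega> X Y Z =
     deriv_along X (\<omega> Y Z) - deriv_along Y (\<omega> X Z) + deriv_along Z (\<omega> X Y)
     - \<omega> (lie_bracket X Y) Z + \<omega> (lie_bracket X Z) Y - \<omega> (lie_bracket Y Z) X"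

definition nijenhuis :: "'m endo \<Rightarrow> 'm vfield \<Rightarrow> 'm vfield \<Rightarrow> 'm vfield" where
  "nijenhuis J X Y =
     lie_bracket (endo_app J X) (endo_app J Y) - endo_app J (lie_bracket (endo_app J X) Y)
     - endo_app J (lie_bracket X (endo_app J Y)) - lie_bracket X Y"

definition kaehler ::
  "('m::topological_space, 'e::euclidean_space) atlas \<Rightarrow> 'm endo \<Rightarrow> 'm metric_tensor \<Rightarrow> bool" where
  "kaehler A J g \<longleftrightarrow>
     almost_hermitian A J g \<and>
     (\<forall>X\<in>vector_fields A. \<forall>Y\<in>vector_fields A. nijenhuis J X Y = 0) \<and>
     (\<forall>X\<in>vector_fields A. \<forall>Y\<in>vector_fields A. \<forall>Z\<in>vector_fields A.
        exterior_deriv2 (fundamental_form J g) X Y Z = 0)"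

type_synonym 'm connection = "'m vfield \<Rightarrow> 'm vfield \<Rightarrow> 'm vfield"

definition is_connection ::
  "('m::topological_space, 'e::euclidean_space) atlas \<Rightarrow> 'm connection \<Rightarrow> bool" where
  "is_connection A D \<longleftrightarrow>
     (\<forall>X\<in>vector_fields A. \<forall>Y\<in>vector_fields A.
        D X Y \<in> vector_fields A \<and>
        (\<forall>Z\<in>vector_fields A. D (X + Y) Z = D X Z + D Y Z \<and> D Z (X + Y) = D Z X + D Z Y) \<and>
        (\<forall>f. smooth_fun A f \<longrightarrow>
           D (scale_field f X) Y = scale_field f (D X Y) \<and>
           D X (scale_field f Y) = scale_field (deriv_along X f) Y + scale_field f (D X Y)))"

definition cov_deriv_metric ::
  "'m connection \<Rightarrow> 'm metric_tensor \<Rightarrow> 'm vfield \<Rightarrow> 'm vfield \<Rightarrow> 'm vfield \<Rightarrow> 'm \<Rightarrow> real" where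
  "cov_deriv_metric D g X Y Z =
     deriv_along X (metric_app g Y Z) - metric_app g (D X Y) Z - metric_app g Y (D X Z)"

definition cov_deriv_endo :: "'m connection \<Rightarrow> 'm endo \<Rightarrow> 'm vfield \<Rightarrow> 'm vfield \<Rightarrow> 'm vfield" where
  "cov_deriv_endo D J X Y = D X (endo_app J Y) - endo_app J (D X Y)"

definition torsion :: "'m connection \<Rightarrow> 'm vfield \<Rightarrow> 'm vfield \<Rightarrow> 'm vfield" where
  "torsion D X Y = D X Y - D Y X - lie_bracket X Y"

definition curvature :: "'m connection \<Rightarrow> 'm vfield \<Rightarrow> 'm vfield \<Rightarrow> 'm vfield \<Rightarrow> 'm vfield" where
  "curvature D X Y Z = D X (D Y Z) - D Y (D X Z) - D (lie_bracket X Y) Z"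

definition levi_civita ::
  "('m::topological_space, 'e::euclidean_space) atlas \<Rightarrow> 'm metric_tensor \<Rightarrow> 'm connection \<Rightarrow> bool" where
  "levi_civita A g D \<longleftrightarrow>
     is_connection A D \<and>
     (\<forall>X\<in>vector_fields A. \<forall>Y\<in>vector_fields A. \<forall>Z\<in>vector_fields A. cov_deriv_metric D g X Y Z = 0) \<and>
     (\<forall>X\<in>vector_fields A. \<forall>Y\<in>vector_fields A. torsion D X Y = 0)"

definition chern_connection ::
  "('m::topological_space, 'e::euclidean_space) atlas \<Rightarrow> 'm endo \<Rightarrow> 'm metric_tensor \<Rightarrow>
     'm connection \<Rightarrow> bool" where
  "chern_connection A J g D \<longleftrightarrow>
     is_connection A D \<and>
     (\<forall>X\<in>vector_fields A. \<forall>Y\<in>vector_fields A. \<forall>Z\<in>vector_fields A. cov_deriv_metric D g X Y Z = 0) \<and>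
     (\<forall>X\<in>vector_fields A. \<forall>Y\<in>vector_fields A. cov_deriv_endo D J X Y = 0) \<and>
     (\<forall>X\<in>vector_fields A. \<forall>Y\<in>vector_fields A.
        torsion D (endo_app J X) (endo_app J Y) = - torsion D X Y)"

definition nearly_kaehler ::
  "('m::topological_space, 'e::euclidean_space) atlas \<Rightarrow> 'm endo \<Rightarrow> 'm metric_tensor \<Rightarrow>
     'm connection \<Rightarrow> bool" where
  "nearly_kaehler A J g D \<longleftrightarrow>
     almost_hermitian A J g \<and> levi_civita A g D \<and>
     (\<forall>X\<in>vector_fields A. \<forall>Y\<in>vector_fields A.
        cov_deriv_endo D J X Y + cov_deriv_endo D J Y X = 0)"

text \<open>A local orthonormal frame around \<open>p\<close> is represented by global vector fields whose
  restrictions to some open neighbourhood of \<open>p\<close> form the frame; every local frame is of this kind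
  after shrinking its domain. Indices start at \<open>0\<close>, so the adaptedness condition on
  \<open>e\<^sub>1, e\<^sub>2, \<dots>\<close> becomes \<open>e (2a + 1) = J (e (2a))\<close>.\<close>

definition orthonormal_frame_on ::
  "('m::topological_space, 'e::euclidean_space) atlas \<Rightarrow> 'm metric_tensor \<Rightarrow> 'm set \<Rightarrow>
     (nat \<Rightarrow> 'm vfield) \<Rightarrow> bool" where
  "orthonormal_frame_on A g U e \<longleftrightarrow>
     (\<forall>i<DIM('e). e i \<in> vector_fields A) \<and>
     (\<forall>q\<in>U. \<forall>i<DIM('e). \<forall>j<DIM('e). g q (e i q) (e j q) = (if i = j then 1 else 0))"

definition orthonormal_frame_at ::
  "('m::topological_space, 'e::euclidean_space) atlas \<Rightarrow> 'm metric_tensor \<Rightarrow> 'm \<Rightarrow>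
     (nat \<Rightarrow> 'm vfield) \<Rightarrow> bool" where
  "orthonormal_frame_at A g p e \<longleftrightarrow> (\<exists>U. open U \<and> p \<in> U \<and> orthonormal_frame_on A g U e)"

definition adapted_frame_at ::
  "('m::topological_space, 'e::euclidean_space) atlas \<Rightarrow> 'm endo \<Rightarrow> 'm metric_tensor \<Rightarrow> 'm \<Rightarrow>
     (nat \<Rightarrow> 'm vfield) \<Rightarrow> bool" where
  "adapted_frame_at A J g p e \<longleftrightarrow>
     (\<exists>U. open U \<and> p \<in> U \<and> orthonormal_frame_on A g U e \<and>
        (\<forall>q\<in>U. \<forall>a. 2 * a + 1 < DIM('e) \<longrightarrow> e (2 * a + 1) q = J q (e (2 * a) q)))"

text \<open>The sums below do not depend on the frame, so choosing one with \<open>SOME\<close> is harmless. The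
  argument \<open>N\<close> is to be the Chern connection of \<open>(J, g)\<close>, the argument \<open>D\<close> the Levi-Civita
  connection of \<open>g\<close>.\<close>

definition chern_scalar ::
  "('m::topological_space, 'e::euclidean_space) atlas \<Rightarrow> 'm endo \<Rightarrow> 'm metric_tensor \<Rightarrow>
     'm connection \<Rightarrow> 'm \<Rightarrow> real" where
  "chern_scalar A J g N p =
     (let e = (SOME e. adapted_frame_at A J g p e) in
       - (1/4) * (\<Sum>i<DIM('e). \<Sum>j<DIM('e).
           metric_app g (curvature N (e i) (endo_app J (e i)) (e j)) (endo_app J (e j)) p))"

definition hermitian_scalar ::
  "('m::topological_space, 'e::euclidean_space) atlas \<Rightarrow> 'm endo \<Rightarrow> 'm metric_tensor \<Rightarrow>
     'm connection \<Rightarrow> 'm \<Rightarrow> real" where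
  "hermitian_scalar A J g N p = 2 * chern_scalar A J g N p"

definition third_scalar ::
  "('m::topological_space, 'e::euclidean_space) atlas \<Rightarrow> 'm endo \<Rightarrow> 'm metric_tensor \<Rightarrow>
     'm connection \<Rightarrow> 'm \<Rightarrow> real" where
  "third_scalar A J g N p =
     (let e = (SOME e. adapted_frame_at A J g p e) in
       1/2 * (\<Sum>i<DIM('e). \<Sum>j<DIM('e).
           metric_app g (curvature N (e i) (e j) (e j)) (e i) p))"

definition riemannian_scalar ::
  "('m::topological_space, 'e::euclidean_space) atlas \<Rightarrow> 'm metric_tensor \<Rightarrow>
     'm connection \<Rightarrow> 'm \<Rightarrow> real" where
  "riemannian_scalar A g D p =
     (let e = (SOME e. orthonormal_frame_at A g p e) in
       (\<Sum>i<DIM('e). \<Sum>j<DIM('e).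
           metric_app g (curvature D (e i) (e j) (e j)) (e i) p))"

end

theory Submission
  imports Defs
begin

text \<open>Let \<open>C = N - D\<close> be the difference of the Chern and the Levi-Civita connection. Both connections are
  metric, so \<open>C\<^sub>X\<close> is a skew endomorphism; \<open>N J = 0\<close>, the nearly Kaehler condition and the type of the
  Chern torsion force in addition \<open>C\<^sub>X Y = - C\<^sub>Y X\<close> and \<open>C\<^sub>X J = - J C\<^sub>X\<close> (lemmas \<open>C_anticommute\<close> and
  \<open>C_j_right\<close>). So the torsion \<open>T = 2 C\<close> of \<open>N\<close> is totally skew, and \<open>D J = 2 J C\<close>. Everything is then
  measured by the energy \<open>E = \<Sum>\<^sub>i\<^sub>j |C (e\<^sub>i, e\<^sub>j)|\<^sup>2\<close>:

  \<^item> Substituting \<open>N = D + C\<close> into the curvature gives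
    \<open>g (R\<^sup>N\<^sub>X\<^sub>Y Y, X) = g (R\<^sup>D\<^sub>X\<^sub>Y Y, X) - |C\<^sub>X Y|\<^sup>2\<close>, because total skewness kills every term that contains a
    derivative of \<open>C\<close> (\<open>sectional_curvature_N\<close>). Summing over a frame, \<open>2 s = s\<^sup>g - E\<close>.

  \<^item> The first Bianchi identity of \<open>N\<close> for \<open>X, J X, Y\<close>, paired with \<open>J Y\<close>, has the right-hand side
    \<open>2 |T (X, Y)|\<^sup>2 = 8 |C\<^sub>X Y|\<^sup>2\<close>: again the derivatives of the torsion drop out (\<open>bianchi_defect\<close>).
    Since \<open>R\<^sup>N\<close> commutes with \<open>J\<close> and the trace may be taken over the frame \<open>(J e\<^sub>i)\<close> as well as over \<open>(e\<^sub>i)\<close>,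
    the trace of this identity is \<open>s\<^sup>H = 2 s - 4 E\<close> (\<open>chern_trace\<close>).

  Thus both gaps are nonnegative multiples of \<open>E\<close>. Equality at every point means \<open>C = 0\<close>; as the Nijenhuis
  tensor equals \<open>8 C\<close> and the fundamental form is closed once \<open>C = 0\<close>, this is the Kaehler condition
  (\<open>kaehler_iff_energy\<close>).

  All this is algebra in the module of vector fields over the smooth functions. The analysis is spent on the
  frames in which the scalar curvatures are computed: they have to exist, and the traces must not depend on
  them. For this, tangent vectors, which are derivations of the global smooth functions, are
  identified with vectors of the model space: bump functions turn coordinate derivations into global vector
  fields, and Hadamard's lemma shows that a derivation is determined by its values on coordinates
  (\<open>ex_tangent_coordinates\<close>). Gram-Schmidt orthogonalisation that adds \<open>W\<close> together with \<open>J W\<close>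
  then produces adapted frames (\<open>ex_adapted_frame\<close>), and tensoriality makes traces independent of the frame
  (\<open>trace_frame_independent\<close>).\<close>

section \<open>Calculus of differentiable functions on open sets\<close>

lemma Ck_on_subset: "Ck_on k S f \<Longrightarrow> T \<subseteq> S \<Longrightarrow> Ck_on k T f"
  by (induction k arbitrary: f) (auto intro: continuous_on_subset)

lemma Ck_on_cong:
  assumes "open S" "\<And>x. x \<in> S \<Longrightarrow> f x = g x" "Ck_on k S f"
  shows "Ck_on k S g"
  using assms(2,3)
proof (induction k arbitrary: f g)
  case 0
  then show ?case using continuous_on_cong[of S S f g] by simp
next
  case (Suc k)
  have der: "(g has_derivative frechet_derivative f (at x)) (at x)" if "x \<in> S" for x
    using has_derivative_transform_within_open[OF _ assms(1) that Suc.prems(1)] Suc.prems(2) that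
    by (simp add: frechet_derivative_works)
  then have eq: "frechet_derivative g (at x) = frechet_derivative f (at x)" if "x \<in> S" for x
    using frechet_derivative_at that by metis
  have "Ck_on k S (\<lambda>x. frechet_derivative g (at x) v)" for v
    using Suc.IH[of "\<lambda>x. frechet_derivative f (at x) v" "\<lambda>x. frechet_derivative g (at x) v"]
      eq Suc.prems(2) by simp
  then show ?case using der by (auto simp: differentiable_def)
qed

text \<open>The recursion for \<open>Ck_on\<close> speaks of \<open>frechet_derivative\<close>, which is only a choice of a derivative; this
  rule lets the derivative be given by an explicit formula.\<close>

lemma Ck_on_SucI:
  assumes "open S" "\<And>x. x \<in> S \<Longrightarrow> (f has_derivative f' x) (at x)"
    and "\<And>v. Ck_on k S (\<lambda>x. f' x v)"
  shows "Ck_on (Suc k) S f"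
proof -
  have "frechet_derivative f (at x) = f' x" if "x \<in> S" for x
    using frechet_derivative_at[OF assms(2)[OF that]] by simp
  then have "Ck_on k S (\<lambda>x. frechet_derivative f (at x) v)" for v
    using Ck_on_cong[OF assms(1) _ assms(3)[of v]] by simp
  then show ?thesis using assms(2) by (auto simp: differentiable_def)
qed

lemma Ck_on_SucD:
  assumes "Ck_on (Suc k) S f" "x \<in> S"
  shows "(f has_derivative frechet_derivative f (at x)) (at x)"
  using assms by (simp add: frechet_derivative_works)

lemma Ck_on_lower: "Ck_on (Suc k) S f \<Longrightarrow> Ck_on k S f"
proof (induction k arbitrary: f)
  case 0
  then show ?case
    by (auto intro!: continuous_at_imp_continuous_on differentiable_imp_continuous_within)
next
  case (Suc k)
  then show ?case by (metis Ck_on.simps(2))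
qed

lemma Ck_on_imp_continuous_on: "Ck_on k S f \<Longrightarrow> continuous_on S f"
  by (induction k) (use Ck_on_lower in \<open>auto simp del: Ck_on.simps(2)\<close>)

lemma Ck_on_local:
  assumes "\<And>x. x \<in> S \<Longrightarrow> \<exists>U. open U \<and> x \<in> U \<and> Ck_on k U f"
  shows "Ck_on k S f"
  using assms
proof (induction k arbitrary: f)
  case 0
  then show ?case
    by (metis Ck_on.simps(1) continuous_at_imp_continuous_on continuous_on_eq_continuous_at)
next
  case (Suc k)
  have "Ck_on k S (\<lambda>x. frechet_derivative f (at x) v)" for v
    using Suc.IH Suc.prems by (metis Ck_on.simps(2))
  then show ?case using Suc.prems by (metis Ck_on.simps(2))
qed

lemma Ck_on_const: "Ck_on k S (\<lambda>x. c)"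
  by (induction k arbitrary: c) auto

lemma Ck_on_bounded_linear:
  assumes "bounded_linear L" "open S" "Ck_on k S f"
  shows "Ck_on k S (\<lambda>x. L (f x))"
  using assms(3)
proof (induction k arbitrary: f)
  case 0
  then show ?case using bounded_linear.continuous_on[OF assms(1)] by simp
next
  case (Suc k)
  show ?case
  proof (rule Ck_on_SucI[OF assms(2)])
    show "((\<lambda>x. L (f x)) has_derivative (\<lambda>v. L (frechet_derivative f (at x) v))) (at x)"
      if "x \<in> S" for x
      using bounded_linear.has_derivative[OF assms(1) Ck_on_SucD[OF Suc.prems that]] .
    show "Ck_on k S (\<lambda>x. L (frechet_derivative f (at x) v))" for v
      using Suc by simp
  qed
qed

lemma Ck_on_ident: "open S \<Longrightarrow> Ck_on k S (\<lambda>x. x)"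
  by (cases k) (auto intro!: Ck_on_SucI[where f' = "\<lambda>x v. v"] Ck_on_const)

lemma Ck_on_add:
  assumes "open S" "Ck_on k S f" "Ck_on k S g"
  shows "Ck_on k S (\<lambda>x. f x + g x)"
  using assms(2,3)
proof (induction k arbitrary: f g)
  case 0
  then show ?case by (simp add: continuous_on_add)
next
  case (Suc k)
  show ?case
    by (rule Ck_on_SucI[OF assms(1),
          where f' = "\<lambda>x v. frechet_derivative f (at x) v + frechet_derivative g (at x) v"])
      (use Suc in \<open>auto intro!: has_derivative_add simp: frechet_derivative_works\<close>)
qed

lemma Ck_on_sum:
  assumes "open S" "\<And>i. i \<in> I \<Longrightarrow> Ck_on k S (f i)"
  shows "Ck_on k S (\<lambda>x. \<Sum>i\<in>I. f i x)"
  using assms(2) by (induction I rule: infinite_finite_induct)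
    (auto intro: Ck_on_const Ck_on_add[OF assms(1)])

lemma Ck_on_mult:
  fixes f g :: "'a::real_normed_vector \<Rightarrow> real"
  assumes "open S" "Ck_on k S f" "Ck_on k S g"
  shows "Ck_on k S (\<lambda>x. f x * g x)"
  using assms(2,3)
proof (induction k arbitrary: f g)
  case 0
  then show ?case by (simp add: continuous_on_mult)
next
  case (Suc k)
  show ?case
  proof (rule Ck_on_SucI[OF assms(1)])
    show "((\<lambda>x. f x * g x) has_derivative
        (\<lambda>v. f x * frechet_derivative g (at x) v + frechet_derivative f (at x) v * g x)) (at x)"
      if "x \<in> S" for x
      using has_derivative_mult[OF Ck_on_SucD[OF Suc.prems(1) that] Ck_on_SucD[OF Suc.prems(2) that]] .
    show "Ck_on k S (\<lambda>x. f x * frechet_derivative g (at x) v + frechet_derivative f (at x) v * g x)"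
      for v
      using Suc.prems Ck_on_lower[OF Suc.prems(1)] Ck_on_lower[OF Suc.prems(2)]
      by (intro Ck_on_add[OF assms(1)] Suc.IH) simp_all
  qed
qed

text \<open>Writing the derivative of \<open>f\<close> in coordinates turns the chain rule into a finite sum of products whose
  factors are one degree less smooth. The induction hypothesis applies to the factors \<open>\<partial>\<^sub>b g \<circ> f\<close>, for which
  \<open>g\<close> must be arbitrary while \<open>f\<close> stays fixed.\<close>

lemma Ck_on_compose:
  fixes f :: "'a::real_normed_vector \<Rightarrow> 'b::euclidean_space" and g :: "'b \<Rightarrow> real"
  assumes "open S" "f ` S \<subseteq> T" "Ck_on k S f" "Ck_on k T g"
  shows "Ck_on k S (\<lambda>x. g (f x))"
  using assms(3,4)
proof (induction k arbitrary: g)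
  case 0
  then show ?case
    using continuous_on_compose2[of T g S f] assms(2) by simp
next
  case (Suc k)
  let ?Df = "\<lambda>x. frechet_derivative f (at x)" and ?Dg = "\<lambda>y. frechet_derivative g (at y)"
  show ?case
  proof (rule Ck_on_SucI[OF assms(1)])
    show "((\<lambda>x. g (f x)) has_derivative (\<lambda>v. \<Sum>b\<in>Basis. (?Df x v \<bullet> b) * ?Dg (f x) b)) (at x)"
      if "x \<in> S" for x
    proof -
      have fx: "f x \<in> T" using assms(2) that by auto
      have "((\<lambda>x. g (f x)) has_derivative (\<lambda>v. ?Dg (f x) (?Df x v))) (at x)"
        using has_derivative_compose[OF Ck_on_SucD[OF Suc.prems(1) that] Ck_on_SucD[OF Suc.prems(2) fx]] .
      moreover have "linear (?Dg (f x))"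
        using Suc.prems(2) fx by (intro linear_frechet_derivative) simp
      then have "?Dg (f x) (?Df x v) = (\<Sum>b\<in>Basis. (?Df x v \<bullet> b) * ?Dg (f x) b)" for v
        using Linear_Algebra.linear_componentwise[of "?Dg (f x)" "?Df x v" 1] by simp
      ultimately show ?thesis by simp
    qed
    show "Ck_on k S (\<lambda>x. \<Sum>b\<in>Basis. (?Df x v \<bullet> b) * ?Dg (f x) b)" for v
    proof (intro Ck_on_sum Ck_on_mult assms(1))
      fix b :: 'b
      show "Ck_on k S (\<lambda>x. ?Df x v \<bullet> b)"
        using Suc.prems by (intro Ck_on_bounded_linear[OF bounded_linear_inner_left assms(1)]) simp
      show "Ck_on k S (\<lambda>x. ?Dg (f x) b)"
        using Suc.IH[of "\<lambda>y. ?Dg y b"] Suc.prems(2) Ck_on_lower[OF Suc.prems(1)] by simp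
    qed
  qed
qed

lemma smooth_on_subset: "smooth_on S f \<Longrightarrow> T \<subseteq> S \<Longrightarrow> smooth_on T f"
  unfolding smooth_on_def using Ck_on_subset by blast

lemma smooth_on_cong: "open S \<Longrightarrow> (\<And>x. x \<in> S \<Longrightarrow> f x = g x) \<Longrightarrow> smooth_on S f \<Longrightarrow> smooth_on S g"
  unfolding smooth_on_def using Ck_on_cong by blast

lemma smooth_on_local:
  "(\<And>x. x \<in> S \<Longrightarrow> \<exists>U. open U \<and> x \<in> U \<and> smooth_on U f) \<Longrightarrow> smooth_on S f"
  unfolding smooth_on_def by (meson Ck_on_local)

lemma smooth_on_const: "smooth_on S (\<lambda>x. c)"
  by (simp add: smooth_on_def Ck_on_const)

lemma smooth_on_ident: "open S \<Longrightarrow> smooth_on S (\<lambda>x. x)"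
  by (simp add: smooth_on_def Ck_on_ident)

lemma smooth_on_bounded_linear:
  "bounded_linear L \<Longrightarrow> open S \<Longrightarrow> smooth_on S f \<Longrightarrow> smooth_on S (\<lambda>x. L (f x))"
  by (simp add: smooth_on_def Ck_on_bounded_linear)

lemma smooth_on_add:
  "open S \<Longrightarrow> smooth_on S f \<Longrightarrow> smooth_on S g \<Longrightarrow> smooth_on S (\<lambda>x. f x + g x)"
  by (simp add: smooth_on_def Ck_on_add)

lemma smooth_on_sum:
  "open S \<Longrightarrow> (\<And>i. i \<in> I \<Longrightarrow> smooth_on S (f i)) \<Longrightarrow> smooth_on S (\<lambda>x. \<Sum>i\<in>I. f i x)"
  by (simp add: smooth_on_def Ck_on_sum)

lemma smooth_on_mult:
  fixes f g :: "'a::real_normed_vector \<Rightarrow> real"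
  shows "open S \<Longrightarrow> smooth_on S f \<Longrightarrow> smooth_on S g \<Longrightarrow> smooth_on S (\<lambda>x. f x * g x)"
  by (simp add: smooth_on_def Ck_on_mult)

lemma smooth_on_compose:
  fixes f :: "'a::real_normed_vector \<Rightarrow> 'b::euclidean_space" and g :: "'b \<Rightarrow> real"
  shows "open S \<Longrightarrow> f ` S \<subseteq> T \<Longrightarrow> smooth_on S f \<Longrightarrow> smooth_on T g \<Longrightarrow> smooth_on S (\<lambda>x. g (f x))"
  unfolding smooth_on_def using Ck_on_compose by blast

lemma smooth_on_has_derivative:
  "smooth_on S f \<Longrightarrow> x \<in> S \<Longrightarrow> (f has_derivative frechet_derivative f (at x)) (at x)"
  unfolding smooth_on_def using Ck_on_SucD by blast

lemma smooth_on_frechet_derivative: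
  "smooth_on S f \<Longrightarrow> smooth_on S (\<lambda>x. frechet_derivative f (at x) v)"
  unfolding smooth_on_def by (metis Ck_on.simps(2))

lemma smooth_on_imp_continuous_on: "smooth_on S f \<Longrightarrow> continuous_on S f"
  unfolding smooth_on_def by (metis Ck_on.simps(1))

section \<open>Bump functions and division by coordinates\<close>

text \<open>The functions \<open>exp (- 1 / t) / t\<^sup>m\<close> on the positive half-line, extended by \<open>0\<close>. The powers of \<open>t\<close> are
  there because the span of the family is closed under differentiation, so one induction treats all derivatives
  of \<open>exp (- 1 / t)\<close>.\<close>

definition flat :: "nat \<Rightarrow> real \<Rightarrow> real" where
  "flat m t = (if t > 0 then exp (- (1 / t)) / t ^ m else 0)"

lemma flat_tendsto_0: "(flat m \<longlongrightarrow> 0) (at 0)"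
proof -
  have "((\<lambda>t. inverse t ^ m / exp (inverse t)) \<longlongrightarrow> 0) (at_right (0::real))"
    using filterlim_compose[OF tendsto_power_div_exp_0 filterlim_inverse_at_top_right] .
  moreover have "\<forall>\<^sub>F t in at_right 0. inverse t ^ m / exp (inverse t) = flat m t"
    by (rule eventually_at_rightI[of 0 1]) (auto simp: flat_def exp_minus field_simps)
  ultimately have "(flat m \<longlongrightarrow> 0) (at_right 0)"
    using tendsto_cong by fast
  moreover have "(flat m \<longlongrightarrow> 0) (at_left 0)"
    by (rule tendsto_eventually, rule eventually_at_leftI[of "-1"]) (auto simp: flat_def)
  ultimately show ?thesis by (simp add: filterlim_split_at)
qed

text \<open>At \<open>0\<close> the difference quotient of \<open>flat m\<close> is \<open>flat (m + 1)\<close>, so the limit above is the derivative.\<close>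

lemma flat_has_field_derivative:
  "(flat m has_field_derivative flat (m + 2) t - real m * flat (m + 1) t) (at t)"
proof -
  consider "t < 0" | "t = 0" | "t > 0" by linarith
  then show ?thesis
  proof cases
    case 1
    have "((\<lambda>_. 0) has_field_derivative 0) (at t)" by simp
    then have "(flat m has_field_derivative 0) (at t)"
      using has_field_derivative_transform_within_open[of "\<lambda>_. 0" 0 t "{..<0}" "flat m"] 1
      by (simp add: flat_def)
    then show ?thesis using 1 by (simp add: flat_def)
  next
    case 2
    have "(\<lambda>h. (flat m (0 + h) - flat m 0) / h) = flat (Suc m)"
      by (auto simp: flat_def fun_eq_iff)
    then show ?thesis using 2 flat_tendsto_0[of "Suc m"]
      by (simp add: DERIV_def flat_def[of _ 0])
  next
    case 3
    have "((\<lambda>t. exp (- (1 / t)) / t ^ m) has_field_derivative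
        exp (- (1 / t)) / t ^ (m + 2) - real m * (exp (- (1 / t)) / t ^ (m + 1))) (at t)"
    proof -
      have "((\<lambda>t. exp (- (1 / t))) has_field_derivative exp (- (1 / t)) * (1 / t\<^sup>2)) (at t)"
        using 3 by (auto intro!: derivative_eq_intros simp: power2_eq_square)
      from DERIV_divide[OF this DERIV_pow[of m t]] 3
      have "((\<lambda>t. exp (- (1 / t)) / t ^ m) has_field_derivative
          (exp (- (1 / t)) * (1 / t\<^sup>2) * t ^ m - exp (- (1 / t)) * (real m * t ^ (m - 1)))
            / (t ^ m * t ^ m)) (at t)" by simp
      then show ?thesis
        by (rule DERIV_cong) (use 3 in \<open>cases m; simp add: field_simps power2_eq_square\<close>)
    qed
    then have "(flat m has_field_derivative
        exp (- (1 / t)) / t ^ (m + 2) - real m * (exp (- (1 / t)) / t ^ (m + 1))) (at t)"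
      by (rule has_field_derivative_transform_within_open[where S = "{0<..}"])
        (use 3 in \<open>auto simp: flat_def\<close>)
    then show ?thesis using 3 by (simp add: flat_def)
  qed
qed

lemma smooth_on_flat: "smooth_on UNIV (flat m)"
proof -
  have "Ck_on k UNIV (flat m)" for k
  proof (induction k arbitrary: m)
    case 0
    show ?case
      using DERIV_isCont[OF flat_has_field_derivative] by (simp add: continuous_at_imp_continuous_on)
  next
    case (Suc k)
    show ?case
    proof (rule Ck_on_SucI)
      show "(flat m has_derivative (\<lambda>v. (flat (m + 2) t + (- real m) * flat (m + 1) t) * v)) (at t)"
        for t
        using flat_has_field_derivative[of m t] by (simp add: has_field_derivative_def)
      show "Ck_on k UNIV (\<lambda>t. (flat (m + 2) t + (- real m) * flat (m + 1) t) * v)" for v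
        using Suc by (intro Ck_on_mult Ck_on_add Ck_on_const) auto
    qed simp
  qed
  then show ?thesis by (simp add: smooth_on_def)
qed

lemma smooth_on_powr: "smooth_on {0<..} (\<lambda>t::real. t powr a)"
proof -
  have "Ck_on k {0<..} (\<lambda>t::real. t powr a)" for k
  proof (induction k arbitrary: a)
    case 0
    show ?case by (auto intro!: continuous_intros)
  next
    case (Suc k)
    show ?case
    proof (rule Ck_on_SucI)
      show "((\<lambda>t. t powr a) has_derivative (\<lambda>v. (a * t powr (a - 1)) * v)) (at t)"
        if "t \<in> {0<..}" for t :: real
        using has_real_derivative_powr[of t a] that by (simp add: has_field_derivative_def)
      show "Ck_on k {0<..} (\<lambda>t. (a * t powr (a - 1)) * v)" for v
        using Suc by (intro Ck_on_mult Ck_on_const) auto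
    qed simp
  qed
  then show ?thesis by (simp add: smooth_on_def)
qed

text \<open>The usual quotient of \<open>flat\<close> functions, which rises from \<open>0\<close> on the nonpositive reals to \<open>1\<close> on
  \<open>t \<ge> 1\<close>. The reciprocal is written as a power so that \<open>smooth_on_powr\<close> covers it.\<close>

definition smooth_step :: "real \<Rightarrow> real" where
  "smooth_step t = flat 0 t * (flat 0 t + flat 0 (1 - t)) powr (-1)"

lemma smooth_step_eq_0: "t \<le> 0 \<Longrightarrow> smooth_step t = 0"
  by (simp add: smooth_step_def flat_def)

lemma smooth_step_eq_1: "t \<ge> 1 \<Longrightarrow> smooth_step t = 1"
  by (simp add: smooth_step_def flat_def powr_minus)

lemma smooth_on_affine:
  "smooth_on UNIV f \<Longrightarrow> smooth_on UNIV (\<lambda>t::real. f (a + b * t) :: real)"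
  using smooth_on_compose[of UNIV "\<lambda>t. a + b * t" UNIV f]
  by (simp add: smooth_on_add smooth_on_mult smooth_on_const smooth_on_ident)

lemma smooth_on_smooth_step: "smooth_on UNIV smooth_step"
proof -
  let ?q = "\<lambda>t. flat 0 t + flat 0 (1 - t)"
  have q: "smooth_on UNIV ?q"
    using smooth_on_affine[OF smooth_on_flat, of 0 1 "-1"]
    by (intro smooth_on_add smooth_on_flat) simp_all
  have "?q t > 0" for t
    by (cases "t > 0") (auto simp: flat_def add_pos_nonneg)
  then have "smooth_on UNIV (\<lambda>t. ?q t powr (-1))"
    by (intro smooth_on_compose[OF _ _ q smooth_on_powr]) auto
  then show ?thesis
    unfolding smooth_step_def[abs_def] by (intro smooth_on_mult smooth_on_flat) auto
qed

lemma ex_bump: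
  fixes c :: "'e::euclidean_space"
  assumes "r > 0"
  shows "\<exists>b. smooth_on UNIV b \<and> b c = (1::real) \<and> (\<forall>x. dist c x \<ge> r \<longrightarrow> b x = 0)"
proof -
  let ?n = "\<lambda>x::'e. \<Sum>i\<in>Basis. (x \<bullet> i + - (c \<bullet> i)) * (x \<bullet> i + - (c \<bullet> i))"
  have n: "?n x = (dist c x)\<^sup>2" for x
  proof -
    have "(dist c x)\<^sup>2 = (x - c) \<bullet> (x - c)"
      by (simp add: dist_norm norm_minus_commute[of c] power2_norm_eq_inner del: inner_diff_right)
    also have "\<dots> = (\<Sum>i\<in>Basis. ((x - c) \<bullet> i) * ((x - c) \<bullet> i))"
      by (rule euclidean_inner)
    also have "\<dots> = ?n x"
      by (rule sum.cong) (auto simp: inner_diff_left)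
    finally show ?thesis by simp
  qed
  have lin: "smooth_on UNIV (\<lambda>x::'e. x \<bullet> i)" for i
    by (rule smooth_on_bounded_linear[OF bounded_linear_inner_left _ smooth_on_ident]) auto
  have "smooth_on UNIV ?n"
    by (intro smooth_on_sum smooth_on_mult smooth_on_add smooth_on_const lin open_UNIV)
  then have "smooth_on UNIV (\<lambda>x. smooth_step (1 + (- (1 / r\<^sup>2)) * ?n x))"
    using smooth_on_compose[OF open_UNIV, of ?n UNIV]
      smooth_on_affine[OF smooth_on_smooth_step, of 1 "- (1 / r\<^sup>2)"] by simp
  moreover have "smooth_step (1 + (- (1 / r\<^sup>2)) * ?n c) = 1"
    by (simp add: smooth_step_eq_1)
  moreover have "smooth_step (1 + (- (1 / r\<^sup>2)) * ?n x) = 0" if "dist c x \<ge> r" for x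
  proof (rule smooth_step_eq_0)
    have "r\<^sup>2 \<le> (dist c x)\<^sup>2" using that assms by (simp add: power_mono)
    then show "1 + (- (1 / r\<^sup>2)) * ?n x \<le> 0" unfolding n using assms by (simp add: field_simps)
  qed
  ultimately show ?thesis by (intro exI[of _ "\<lambda>x. smooth_step (1 + (- (1 / r\<^sup>2)) * ?n x)"]) blast
qed

text \<open>Normalising a vector field needs \<open>t \<mapsto> 1 / sqrt t\<close>, which is singular at \<open>0\<close>. Cut off below \<open>c / 4\<close> it
  is smooth on the whole line, so its composition with a global smooth function is again global.\<close>

lemma ex_smooth_inverse_sqrt:
  fixes c :: real
  assumes "c > 0"
  shows "\<exists>r. smooth_on UNIV r \<and> (\<forall>t \<ge> c / 2. (r t)\<^sup>2 * t = 1)"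
proof -
  let ?r = "\<lambda>t::real. smooth_step (-1 + (4 / c) * t) * t powr (-1/2)"
  have st: "smooth_on UNIV (\<lambda>t. smooth_step (-1 + (4 / c) * t))"
    by (rule smooth_on_affine[OF smooth_on_smooth_step])
  have "smooth_on UNIV ?r"
  proof (rule smooth_on_local)
    fix x :: real
    show "\<exists>U. open U \<and> x \<in> U \<and> smooth_on U ?r"
    proof (cases "x > 0")
      case True
      have "smooth_on {0<..} ?r"
        by (intro smooth_on_mult smooth_on_powr smooth_on_subset[OF st]) auto
      then show ?thesis using True by (intro exI[of _ "{0<..}"]) auto
    next
      case False
      have "smooth_on {..<c / 4} ?r"
        by (rule smooth_on_cong[OF _ _ smooth_on_const[of _ 0]])
          (use assms in \<open>auto simp: smooth_step_eq_0 field_simps\<close>)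
      then show ?thesis using False assms by (intro exI[of _ "{..<c / 4}"]) auto
    qed
  qed
  moreover have "(?r t)\<^sup>2 * t = 1" if "t \<ge> c / 2" for t
  proof -
    have t: "t > 0" using that assms by linarith
    have "smooth_step (-1 + (4 / c) * t) = 1"
      by (rule smooth_step_eq_1) (use that assms in \<open>simp add: field_simps\<close>)
    moreover have "(t powr (-1/2))\<^sup>2 = t powr (-1)"
      using t by (simp add: power2_eq_square flip: powr_add)
    ultimately show ?thesis using t by (simp add: powr_minus)
  qed
  ultimately show ?thesis by blast
qed

lemma ray_in_ball:
  fixes c x :: "'e::real_normed_vector"
  assumes "x \<in> ball c r" "t \<in> {0..1::real}"
  shows "c + t *\<^sub>R (x - c) \<in> ball c r"
proof -
  have "\<bar>t\<bar> * norm (x - c) \<le> 1 * norm (x - c)" using assms by (intro mult_right_mono) auto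
  then show ?thesis using assms(1) by (simp add: dist_norm norm_minus_commute)
qed

lemma continuous_on_ray:
  fixes F :: "'e::euclidean_space \<Rightarrow> real"
  assumes "continuous_on (ball c r) F"
  shows "continuous_on (ball c r \<times> cbox 0 (1::real)) (\<lambda>(x, t). t ^ m * F (c + t *\<^sub>R (x - c)))"
proof -
  have "continuous_on (ball c r \<times> cbox 0 (1::real)) (\<lambda>z. F (c + snd z *\<^sub>R (fst z - c)))"
    by (rule continuous_on_compose2[OF assms])
      (use ray_in_ball[of _ c r] in \<open>auto intro!: continuous_intros\<close>)
  then show ?thesis by (auto intro!: continuous_intros simp: case_prod_unfold)
qed

lemma continuous_on_Pair_const: "continuous_on S (Pair x)"
  using continuous_on_Pair[OF continuous_on_const continuous_on_id, of S x] by simp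

lemma continuous_on_ray_at:
  fixes F :: "'e::euclidean_space \<Rightarrow> real"
  assumes "continuous_on (ball c r) F" "x \<in> ball c r"
  shows "continuous_on (cbox 0 (1::real)) (\<lambda>t. t ^ m * F (c + t *\<^sub>R (x - c)))"
  using continuous_on_compose2[OF continuous_on_ray[OF assms(1), where m = m]
      continuous_on_Pair_const] assms(2)
  by (simp add: image_subset_iff del: box_real)

text \<open>Differentiation under the integral sign multiplies the integrand by the inner derivative \<open>t\<close>; with the
  factor \<open>t ^ m\<close> in the statement the induction on \<open>k\<close> closes.\<close>

lemma Ck_on_ray_integral:
  fixes F :: "'e::euclidean_space \<Rightarrow> real"
  assumes "Ck_on k (ball c r) F"
  shows "Ck_on k (ball c r) (\<lambda>x. integral (cbox 0 1) (\<lambda>t. t ^ m * F (c + t *\<^sub>R (x - c))))"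
  using assms
proof (induction k arbitrary: m F)
  case 0
  then show ?case
    using integral_continuous_on_param[OF continuous_on_ray] by (simp del: box_real)
next
  case (Suc k)
  let ?B = "ball c r" and ?D = "\<lambda>y. frechet_derivative F (at y)"
  \<comment> \<open>the derivative in \<open>x\<close> of the integrand, as a bounded linear function\<close>
  define fx where "fx x t = (\<Sum>b\<in>Basis. (t ^ (m + 1) * ?D (c + t *\<^sub>R (x - c)) b) *\<^sub>R
      blinfun_inner_left b)" for x and t :: real
  have contD: "continuous_on ?B (\<lambda>y. ?D y b)" for b
    using Suc.prems by (auto intro: Ck_on_imp_continuous_on)
  have cont: "continuous_on (?B \<times> cbox 0 1) (\<lambda>(x, t). fx x t)"
    unfolding fx_def case_prod_unfold
    using continuous_on_ray[OF contD, where m = "m + 1"]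
    by (intro continuous_on_sum continuous_on_scaleR continuous_on_const)
      (simp add: case_prod_unfold del: box_real)
  have linD: "linear (?D y)" if "y \<in> ?B" for y
    using Suc.prems that by (intro linear_frechet_derivative) simp
  have fx: "fx x t v = t ^ (m + 1) * ?D (c + t *\<^sub>R (x - c)) v"
    if "x \<in> ?B" "t \<in> cbox 0 1" for x t v
  proof -
    have "?D (c + t *\<^sub>R (x - c)) v = (\<Sum>b\<in>Basis. (v \<bullet> b) * ?D (c + t *\<^sub>R (x - c)) b)"
      using Linear_Algebra.linear_componentwise[of "?D (c + t *\<^sub>R (x - c))" v 1]
        linD ray_in_ball[of x c r t] that by simp
    then show ?thesis
      by (simp add: fx_def blinfun.sum_left blinfun.scaleR_left sum_distrib_left algebra_simps)
  qed
  have der: "((\<lambda>x. t ^ m * F (c + t *\<^sub>R (x - c))) has_derivative fx x t) (at x within ?B)"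
    if "x \<in> ?B" "t \<in> cbox 0 1" for x t
  proof -
    have y: "c + t *\<^sub>R (x - c) \<in> ?B" using ray_in_ball[of x c r t] that by simp
    have "((\<lambda>x. c + t *\<^sub>R (x - c)) has_derivative (\<lambda>v. t *\<^sub>R v)) (at x)"
      by (auto intro!: derivative_eq_intros simp: algebra_simps)
    from has_derivative_compose[OF this, where g = F, OF Ck_on_SucD[OF Suc.prems y]]
    have "((\<lambda>x. t ^ m * F (c + t *\<^sub>R (x - c))) has_derivative
        (\<lambda>v. t ^ m * ?D (c + t *\<^sub>R (x - c)) (t *\<^sub>R v))) (at x)"
      by (rule has_derivative_mult_right)
    moreover have "(\<lambda>v. t ^ m * ?D (c + t *\<^sub>R (x - c)) (t *\<^sub>R v)) = fx x t"
      using fx[OF that] linear_scale[OF linD[OF y]] by (auto simp: fun_eq_iff)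
    ultimately show ?thesis by (simp add: has_derivative_at_withinI)
  qed
  have intg: "(\<lambda>t. t ^ m * F (c + t *\<^sub>R (x - c))) integrable_on cbox 0 1" if "x \<in> ?B" for x
  proof (rule integrable_continuous)
    show "continuous_on (cbox 0 1) (\<lambda>t. t ^ m * F (c + t *\<^sub>R (x - c)))"
      using continuous_on_ray_at[OF Ck_on_imp_continuous_on[OF Suc.prems] that] .
  qed
  have fxint: "fx x integrable_on cbox 0 1" if "x \<in> ?B" for x
  proof (rule integrable_continuous)
    show "continuous_on (cbox 0 1) (fx x)"
      using continuous_on_compose2[OF cont continuous_on_Pair_const] that
      by (simp add: image_subset_iff del: box_real)
  qed
  show ?case
  proof (rule Ck_on_SucI)
    fix x assume x: "x \<in> ?B"
    have "((\<lambda>x. integral (cbox 0 1) (\<lambda>t. t ^ m * F (c + t *\<^sub>R (x - c)))) has_derivative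
        integral (cbox 0 1) (fx x)) (at x within ?B)"
      by (rule leibniz_rule[OF der intg cont x convex_ball])
    moreover have "blinfun_apply (integral (cbox 0 1) (fx x)) =
        (\<lambda>v. integral (cbox 0 1) (\<lambda>t. t ^ (m + 1) * ?D (c + t *\<^sub>R (x - c)) v))"
    proof
      fix v
      have "blinfun_apply (integral (cbox 0 1) (fx x)) v = integral (cbox 0 1) (\<lambda>t. fx x t v)"
        using integral_linear[OF fxint[OF x] blinfun.bounded_linear_left[of v]] by (simp add: o_def)
      also have "\<dots> = integral (cbox 0 1) (\<lambda>t. t ^ (m + 1) * ?D (c + t *\<^sub>R (x - c)) v)"
        by (rule integral_cong) (rule fx[OF x])
      finally show "blinfun_apply (integral (cbox 0 1) (fx x)) v = \<dots>" .
    qed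
    ultimately show "((\<lambda>x. integral (cbox 0 1) (\<lambda>t. t ^ m * F (c + t *\<^sub>R (x - c)))) has_derivative
        (\<lambda>v. integral (cbox 0 1) (\<lambda>t. t ^ (m + 1) * ?D (c + t *\<^sub>R (x - c)) v))) (at x)"
      using x by (simp add: at_within_open[of x ?B])
  next
    show "Ck_on k ?B (\<lambda>x. integral (cbox 0 1) (\<lambda>t. t ^ (m + 1) * ?D (c + t *\<^sub>R (x - c)) v))" for v
      by (rule Suc.IH) (use Suc.prems in simp)
  qed simp
qed

text \<open>Hadamard's lemma, from \<open>f x - f c = \<integral>\<^sub>0\<^sup>1 f' (c + t (x - c)) (x - c) dt\<close>. It is what makes the space
  of derivations finite-dimensional: a derivation at \<open>c\<close> sees only the factors \<open>(x - c) \<bullet> b\<close>.\<close>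

lemma hadamard:
  fixes f :: "'e::euclidean_space \<Rightarrow> real"
  assumes "smooth_on (ball c r) f"
  shows "\<exists>h. (\<forall>b. smooth_on (ball c r) (h b)) \<and>
    (\<forall>x\<in>ball c r. f x = f c + (\<Sum>b\<in>Basis. ((x - c) \<bullet> b) * h b x))"
proof (intro exI conjI allI ballI)
  let ?D = "\<lambda>y. frechet_derivative f (at y)"
  let ?h = "\<lambda>b x. integral (cbox 0 1) (\<lambda>t::real. t ^ 0 * ?D (c + t *\<^sub>R (x - c)) b)"
  have smD: "smooth_on (ball c r) (\<lambda>y. ?D y b)" for b
    by (rule smooth_on_frechet_derivative[OF assms])
  show "smooth_on (ball c r) (?h b)" for b
    using smD[of b] unfolding smooth_on_def by (intro allI Ck_on_ray_integral) blast
  fix x assume x: "x \<in> ball c r"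
  have intg: "(\<lambda>t. ?D (c + t *\<^sub>R (x - c)) b) integrable_on cbox 0 (1::real)" for b
  proof (rule integrable_continuous)
    show "continuous_on (cbox 0 1) (\<lambda>t. ?D (c + t *\<^sub>R (x - c)) b)"
      using continuous_on_ray_at[OF smooth_on_imp_continuous_on[OF smD] x, where m = 0] by simp
  qed
  have der: "((\<lambda>t. f (c + t *\<^sub>R (x - c))) has_vector_derivative
      ?D (c + t *\<^sub>R (x - c)) (x - c)) (at t within {0..1})" if "t \<in> {0..1}" for t
  proof -
    have y: "c + t *\<^sub>R (x - c) \<in> ball c r" using ray_in_ball[OF x that] .
    have "((\<lambda>t. c + t *\<^sub>R (x - c)) has_derivative (\<lambda>v. v *\<^sub>R (x - c))) (at t within {0..1})"
      by (auto intro!: derivative_eq_intros)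
    from has_derivative_compose[OF this smooth_on_has_derivative[OF assms y]]
    show ?thesis
      using linear_scale[OF has_derivative_linear[OF smooth_on_has_derivative[OF assms y]]]
      by (simp add: has_vector_derivative_def)
  qed
  have "((\<lambda>t. ?D (c + t *\<^sub>R (x - c)) (x - c)) has_integral f x - f c) {0..1}"
    using fundamental_theorem_of_calculus[OF _ der] by simp
  moreover have "?D (c + t *\<^sub>R (x - c)) (x - c)
      = (\<Sum>b\<in>Basis. ((x - c) \<bullet> b) * ?D (c + t *\<^sub>R (x - c)) b)" if "t \<in> {0..1}" for t
    using Linear_Algebra.linear_componentwise[of "?D (c + t *\<^sub>R (x - c))" "x - c" 1]
      has_derivative_linear[OF smooth_on_has_derivative[OF assms ray_in_ball[OF x that]]] by simp
  ultimately have "((\<lambda>t. \<Sum>b\<in>Basis. ((x - c) \<bullet> b) * ?D (c + t *\<^sub>R (x - c)) b)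
      has_integral f x - f c) {0..1}"
    by (rule has_integral_eq[rotated])
  then have "f x - f c = integral {0..1} (\<lambda>t. \<Sum>b\<in>Basis. ((x - c) \<bullet> b) * ?D (c + t *\<^sub>R (x - c)) b)"
    by (rule integral_unique[symmetric])
  also have "\<dots> = (\<Sum>b\<in>Basis. integral {0..1} (\<lambda>t. ((x - c) \<bullet> b) * ?D (c + t *\<^sub>R (x - c)) b))"
    using intg by (intro integral_sum integrable_on_mult_right) auto
  also have "\<dots> = (\<Sum>b\<in>Basis. ((x - c) \<bullet> b) * ?h b x)"
    by simp
  finally show "f x = f c + (\<Sum>b\<in>Basis. ((x - c) \<bullet> b) * ?h b x)" by simp
qed

section \<open>Smooth functions and tangent spaces\<close>

lemma sum_fun_apply: "(\<Sum>i\<in>I. F i) x = (\<Sum>i\<in>I. F i x)"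
  by (induction I rule: infinite_finite_induct) auto

lemma scale_tvec_apply [simp]: "scale_tvec c v f = c * v f"
  by (simp add: scale_tvec_def)

lemma scale_field_apply [simp]: "scale_field h X p = scale_tvec (h p) (X p)"
  by (simp add: scale_field_def)

locale smooth_manifold =
  fixes A :: "('m::t2_space, 'e::euclidean_space) atlas"
  assumes smooth_atlas: "smooth_atlas A"
begin

lemma ex_chart: "\<exists>U \<phi>. (U, \<phi>) \<in> A \<and> p \<in> U"
proof -
  have "p \<in> (\<Union>(U, \<phi>)\<in>A. U)" using smooth_atlas by (simp add: smooth_atlas_def)
  then show ?thesis by auto
qed

lemma chart:
  assumes "(U, \<phi>) \<in> A"
  shows chart_open: "open U" and chart_image_open: "open (\<phi> ` U)"
    and chart_homeomorphism: "homeomorphism U (\<phi> ` U) \<phi> (inv_into U \<phi>)"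
  using smooth_atlas assms by (auto simp: smooth_atlas_def)

lemma chart_inv: "(U, \<phi>) \<in> A \<Longrightarrow> q \<in> U \<Longrightarrow> inv_into U \<phi> (\<phi> q) = q"
  using chart_homeomorphism by (auto simp: homeomorphism_def)

lemma chart_image_open_subset:
  assumes "(U, \<phi>) \<in> A" "open W" "W \<subseteq> U"
  shows "open (\<phi> ` W)"
proof -
  have "openin (top_of_set (\<phi> ` U)) (\<phi> ` W)"
    using homeomorphism_imp_open_map[OF chart_homeomorphism[OF assms(1)]]
      assms chart_open[OF assms(1)] by (simp add: openin_open_eq)
  then show ?thesis using chart_image_open[OF assms(1)] by (simp add: openin_open_eq)
qed

lemma transition_smooth:
  assumes "(U, \<phi>) \<in> A" "(V, \<psi>) \<in> A"
  shows "smooth_on (\<phi> ` (U \<inter> V)) (\<lambda>x. \<psi> (inv_into U \<phi> x))"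
  using smooth_atlas assms by (fastforce simp: smooth_atlas_def o_def)

lemma smooth_funD: "smooth_fun A f \<Longrightarrow> (U, \<phi>) \<in> A \<Longrightarrow> smooth_on (\<phi> ` U) (\<lambda>x. f (inv_into U \<phi> x))"
  by (auto simp: smooth_fun_def o_def)

lemma smooth_funI:
  "(\<And>U \<phi>. (U, \<phi>) \<in> A \<Longrightarrow> smooth_on (\<phi> ` U) (\<lambda>x. f (inv_into U \<phi> x))) \<Longrightarrow> smooth_fun A f"
  by (auto simp: smooth_fun_def o_def)

lemma smooth_fun_const: "smooth_fun A (\<lambda>_. c)"
  by (auto intro: smooth_funI smooth_on_const)

lemma smooth_fun_zero: "smooth_fun A 0"
  using smooth_fun_const[of 0] by (simp add: zero_fun_def)

lemma smooth_fun_add: "smooth_fun A f \<Longrightarrow> smooth_fun A h \<Longrightarrow> smooth_fun A (f + h)"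
  by (rule smooth_funI) (simp add: smooth_on_add chart_image_open smooth_funD)

lemma smooth_fun_mult: "smooth_fun A f \<Longrightarrow> smooth_fun A h \<Longrightarrow> smooth_fun A (f * h)"
  by (rule smooth_funI) (simp add: smooth_on_mult chart_image_open smooth_funD)

lemma smooth_fun_cmult: "smooth_fun A f \<Longrightarrow> smooth_fun A (\<lambda>q. c * f q)"
  using smooth_fun_mult[OF smooth_fun_const, of f c] by (simp add: times_fun_def)

lemma smooth_fun_minus: "smooth_fun A f \<Longrightarrow> smooth_fun A (- f)"
  using smooth_fun_cmult[of f "-1"] by (simp add: fun_Compl_def)

lemma smooth_fun_diff: "smooth_fun A f \<Longrightarrow> smooth_fun A h \<Longrightarrow> smooth_fun A (f - h)"
  using smooth_fun_add[OF _ smooth_fun_minus, of f h] by simp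

lemma smooth_fun_sum:
  "(\<And>i. i \<in> I \<Longrightarrow> smooth_fun A (F i)) \<Longrightarrow> smooth_fun A (\<Sum>i\<in>I. F i)"
  by (induction I rule: infinite_finite_induct) (auto intro: smooth_fun_zero smooth_fun_add)

lemma smooth_fun_compose:
  "smooth_fun A f \<Longrightarrow> smooth_on UNIV (r :: real \<Rightarrow> real) \<Longrightarrow> smooth_fun A (\<lambda>q. r (f q))"
  by (rule smooth_funI, rule smooth_on_compose[where g = r and T = UNIV])
    (auto simp: chart_image_open smooth_funD)

lemma smooth_fun_continuous:
  assumes "smooth_fun A f"
  shows "continuous_on UNIV f"
proof -
  have "isCont f p" for p
  proof -
    obtain U \<phi> where c: "(U, \<phi>) \<in> A" "p \<in> U" using ex_chart by blast
    have "continuous_on U (\<lambda>q. f (inv_into U \<phi> (\<phi> q)))"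
      using continuous_on_compose2[OF smooth_on_imp_continuous_on[OF smooth_funD[OF assms c(1)]] _ order_refl]
        chart_homeomorphism[OF c(1)] by (auto simp: homeomorphism_def)
    then have "continuous_on U f"
      using continuous_on_cong[OF refl, of U "\<lambda>q. f (inv_into U \<phi> (\<phi> q))" f] chart_inv[OF c(1)]
      by simp
    then show ?thesis
      using c chart_open continuous_on_eq_continuous_at by blast
  qed
  then show ?thesis by (simp add: continuous_at_imp_continuous_on)
qed

text \<open>In any other chart the function is the given one, read through a transition map, near points of \<open>K\<close>, and
  it vanishes on the complement of \<open>K\<close>, which is open because \<open>K\<close> is closed.\<close>

lemma smooth_fun_extend_by_zero:
  assumes c: "(U, \<phi>) \<in> A" and O: "open O'" "O' \<subseteq> U" and K: "closed K" "K \<subseteq> O'"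
    and h0: "\<And>q. q \<notin> K \<Longrightarrow> h q = 0" and h: "smooth_on (\<phi> ` O') (\<lambda>x. h (inv_into U \<phi> x))"
  shows "smooth_fun A h"
proof (rule smooth_funI)
  fix V \<psi> assume d: "(V, \<psi>) \<in> A"
  show "smooth_on (\<psi> ` V) (\<lambda>x. h (inv_into V \<psi> x))"
  proof (rule smooth_on_local)
    fix x assume "x \<in> \<psi> ` V"
    then obtain q where q: "q \<in> V" "x = \<psi> q" by blast
    show "\<exists>W. open W \<and> x \<in> W \<and> smooth_on W (\<lambda>x. h (inv_into V \<psi> x))"
    proof (cases "q \<in> K")
      case True
      let ?W = "\<psi> ` (V \<inter> O')"
      have W: "open ?W"
        using chart_image_open_subset[OF d] chart_open[OF d] O by (simp add: open_Int)
      have "smooth_on ?W (\<lambda>x. \<phi> (inv_into V \<psi> x))"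
        by (rule smooth_on_subset[OF transition_smooth[OF d c]]) (use O in auto)
      then have "smooth_on ?W (\<lambda>x. h (inv_into U \<phi> (\<phi> (inv_into V \<psi> x))))"
        by (intro smooth_on_compose[OF W _ _ h]) (auto simp: chart_inv[OF d])
      then have "smooth_on ?W (\<lambda>x. h (inv_into V \<psi> x))"
        by (rule smooth_on_cong[OF W, rotated]) (use O in \<open>auto simp: chart_inv[OF d] chart_inv[OF c]\<close>)
      then show ?thesis using W q True K by blast
    next
      case False
      let ?W = "\<psi> ` (V - K)"
      have W: "open ?W"
        using chart_image_open_subset[OF d] chart_open[OF d] K by (simp add: open_Diff)
      have "smooth_on ?W (\<lambda>x. h (inv_into V \<psi> x))"
        by (rule smooth_on_cong[OF W _ smooth_on_const[of _ 0]]) (auto simp: chart_inv[OF d] h0)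
      then show ?thesis using W q False by blast
    qed
  qed
qed

lemma smooth_fun_cutoff:
  assumes "(U, \<phi>) \<in> A" "open O'" "O' \<subseteq> U" "closed K" "K \<subseteq> O'"
    and b: "smooth_fun A \<beta>" "\<And>q. q \<notin> K \<Longrightarrow> \<beta> q = 0" and u: "smooth_on (\<phi> ` O') u"
  shows "smooth_fun A (\<lambda>q. \<beta> q * u (\<phi> q))"
proof (rule smooth_fun_extend_by_zero[OF assms(1-5)])
  have W: "open (\<phi> ` O')" using chart_image_open_subset assms by blast
  have "smooth_on (\<phi> ` O') (\<lambda>x. \<beta> (inv_into U \<phi> x) * u x)"
    using assms(3) by (intro smooth_on_mult[OF W _ u] smooth_on_subset[OF smooth_funD[OF b(1) assms(1)]]) auto
  then show "smooth_on (\<phi> ` O') (\<lambda>x. \<beta> (inv_into U \<phi> x) * u (\<phi> (inv_into U \<phi> x)))"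
    by (rule smooth_on_cong[OF W, rotated]) (use assms(3) in \<open>auto simp: chart_inv[OF assms(1)] subset_eq\<close>)
qed (simp add: b)

text \<open>The support must be closed in the manifold and not only in the chart. It is the preimage of a closed
  ball, which is compact, so the Hausdorff property gives this.\<close>

lemma ex_bump_in_chart:
  assumes c: "(U, \<phi>) \<in> A" and O: "open O'" "O' \<subseteq> U" and p: "p \<in> O'"
  shows "\<exists>\<beta> K. smooth_fun A \<beta> \<and> closed K \<and> K \<subseteq> O' \<and> (\<forall>q. q \<notin> K \<longrightarrow> \<beta> q = 0) \<and> \<beta> p = 1"
proof -
  have W: "open (\<phi> ` O')" using chart_image_open_subset c O by blast
  then obtain r where r: "r > 0" "cball (\<phi> p) r \<subseteq> \<phi> ` O'"
    using p open_contains_cball by blast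
  obtain b where b: "smooth_on UNIV b" "b (\<phi> p) = (1::real)" "\<And>x. dist (\<phi> p) x \<ge> r \<Longrightarrow> b x = 0"
    using ex_bump[OF r(1)] by blast
  define K where "K = inv_into U \<phi> ` cball (\<phi> p) r"
  define \<beta> where "\<beta> q = (if q \<in> U then b (\<phi> q) else 0)" for q
  have "continuous_on (cball (\<phi> p) r) (inv_into U \<phi>)"
    using chart_homeomorphism[OF c] r(2) O(2) continuous_on_subset
    unfolding homeomorphism_def by (metis image_mono order_trans)
  then have K: "closed K" unfolding K_def using compact_imp_closed compact_continuous_image compact_cball by blast
  have KO: "K \<subseteq> O'" using r(2) O(2) chart_inv[OF c] by (fastforce simp: K_def)
  have K0: "\<beta> q = 0" if "q \<notin> K" for q
  proof (cases "q \<in> U")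
    case True
    then have "\<not> dist (\<phi> p) (\<phi> q) \<le> r"
      using that chart_inv[OF c True] unfolding K_def by (metis imageI mem_cball)
    then show ?thesis using b(3) by (simp add: \<beta>_def)
  qed (simp add: \<beta>_def)
  have "smooth_on (\<phi> ` O') (\<lambda>x. \<beta> (inv_into U \<phi> x))"
    by (rule smooth_on_cong[OF W _ smooth_on_subset[OF b(1)]])
      (use O(2) in \<open>auto simp: \<beta>_def chart_inv[OF c] subset_eq\<close>)
  then have "smooth_fun A \<beta>"
    using smooth_fun_extend_by_zero[OF c O K KO] K0 by blast
  moreover have "\<beta> p = 1" using p O by (auto simp: \<beta>_def b)
  ultimately show ?thesis using K KO K0 by blast
qed

lemma ex_bump_in_open:
  assumes "open W" "p \<in> W"
  shows "\<exists>\<beta>. smooth_fun A \<beta> \<and> (\<forall>q. q \<notin> W \<longrightarrow> \<beta> q = 0) \<and> \<beta> p = 1"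
proof -
  obtain U \<phi> where c: "(U, \<phi>) \<in> A" "p \<in> U" using ex_chart by blast
  then show ?thesis
    using ex_bump_in_chart[OF c(1), of "U \<inter> W" p] assms chart_open[OF c(1)] by blast
qed

lemma tangent_spaceD:
  assumes "v \<in> tangent_space A p"
  shows tangent_nonsmooth: "\<not> smooth_fun A f \<Longrightarrow> v f = 0"
    and tangent_add: "smooth_fun A f \<Longrightarrow> smooth_fun A h \<Longrightarrow> v (f + h) = v f + v h"
    and tangent_mult: "smooth_fun A f \<Longrightarrow> smooth_fun A h \<Longrightarrow> v (f * h) = f p * v h + h p * v f"
    and tangent_cmult: "smooth_fun A f \<Longrightarrow> v (\<lambda>x. c * f x) = c * v f"
  using assms by (auto simp: tangent_space_def)

lemma tangent_zero:
  assumes "v \<in> tangent_space A p"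
  shows "v 0 = 0"
  using tangent_cmult[OF assms smooth_fun_zero, of 0] by (simp add: zero_fun_def)

lemma tangent_minus:
  assumes "v \<in> tangent_space A p" "smooth_fun A f"
  shows "v (- f) = - v f"
  using tangent_cmult[OF assms, of "-1"] by (simp add: fun_Compl_def)

lemma tangent_diff:
  assumes "v \<in> tangent_space A p" "smooth_fun A f" "smooth_fun A h"
  shows "v (f - h) = v f - v h"
  using tangent_add[OF assms(1,2) smooth_fun_minus[OF assms(3)]] tangent_minus[OF assms(1,3)] by simp

lemma tangent_const:
  assumes "v \<in> tangent_space A p"
  shows "v (\<lambda>_. c) = 0"
proof -
  have "v (\<lambda>_. 1) = 0"
    using tangent_mult[OF assms smooth_fun_const smooth_fun_const, of 1 1]
    by (simp add: times_fun_def)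
  then show ?thesis using tangent_cmult[OF assms smooth_fun_const[of 1], of c] by simp
qed

lemma tangent_sum:
  assumes "v \<in> tangent_space A p" "\<And>i. i \<in> I \<Longrightarrow> smooth_fun A (F i)"
  shows "v (\<Sum>i\<in>I. F i) = (\<Sum>i\<in>I. v (F i))"
  using assms(2) by (induction I rule: infinite_finite_induct)
    (auto simp: tangent_zero[OF assms(1)] tangent_add[OF assms(1)] smooth_fun_sum)

lemma tangent_space_add:
  "u \<in> tangent_space A p \<Longrightarrow> v \<in> tangent_space A p \<Longrightarrow> u + v \<in> tangent_space A p"
  by (auto simp: tangent_space_def algebra_simps)

lemma tangent_space_scale: "u \<in> tangent_space A p \<Longrightarrow> scale_tvec c u \<in> tangent_space A p"
  by (auto simp: tangent_space_def algebra_simps)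

lemma tangent_space_zero: "0 \<in> tangent_space A p"
  by (auto simp: tangent_space_def)

lemma tangent_space_minus: "u \<in> tangent_space A p \<Longrightarrow> - u \<in> tangent_space A p"
  by (auto simp: tangent_space_def algebra_simps)

lemma tangent_space_diff:
  "u \<in> tangent_space A p \<Longrightarrow> v \<in> tangent_space A p \<Longrightarrow> u - v \<in> tangent_space A p"
  by (auto simp: tangent_space_def algebra_simps)

lemma tangent_space_sum:
  "(\<And>i. i \<in> I \<Longrightarrow> u i \<in> tangent_space A p) \<Longrightarrow> (\<Sum>i\<in>I. u i) \<in> tangent_space A p"
  by (induction I rule: infinite_finite_induct) (auto intro: tangent_space_zero tangent_space_add)

lemma chart_derivation:
  fixes a :: 'e
  assumes "(U, \<phi>) \<in> A" "q \<in> U" "smooth_fun A f" "smooth_fun A h"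
  defines "der \<equiv> \<lambda>f. frechet_derivative (\<lambda>x. f (inv_into U \<phi> x)) (at (\<phi> q)) a"
  shows "der (f * h) = f q * der h + h q * der f" and "der (f + h) = der f + der h"
    and "der (\<lambda>x. c * f x) = c * der f"
proof -
  note f = smooth_on_has_derivative[OF smooth_funD[OF assms(3,1)] imageI[OF assms(2)]]
  note h = smooth_on_has_derivative[OF smooth_funD[OF assms(4,1)] imageI[OF assms(2)]]
  note [simp] = chart_inv[OF assms(1,2)]
  show "der (f * h) = f q * der h + h q * der f"
    using fun_cong[OF frechet_derivative_at[OF has_derivative_mult[OF f h]], of a]
    by (simp add: der_def mult.commute)
  show "der (f + h) = der f + der h"
    using fun_cong[OF frechet_derivative_at[OF has_derivative_add[OF f h]], of a]
    by (simp add: der_def)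
  show "der (\<lambda>x. c * f x) = c * der f"
    using fun_cong[OF frechet_derivative_at[OF has_derivative_mult_right[OF f, of c]], of a]
    by (simp add: der_def)
qed

text \<open>A directional derivative in a chart, multiplied by a bump function so that it becomes a global field.
  It is set to zero on nonsmooth functions because tangent vectors are.\<close>

lemma ex_coordinate_field:
  assumes c: "(U, \<phi>) \<in> A" and K: "closed K" "K \<subseteq> U"
    and b: "smooth_fun A \<beta>" "\<And>q. q \<notin> K \<Longrightarrow> \<beta> q = 0"
  shows "\<exists>E\<in>vector_fields A. \<forall>q f. smooth_fun A f \<longrightarrow>
    E q f = \<beta> q * frechet_derivative (\<lambda>x. f (inv_into U \<phi> x)) (at (\<phi> q)) a"
proof -
  define E where "E q f = (if smooth_fun A f
    then \<beta> q * frechet_derivative (\<lambda>x. f (inv_into U \<phi> x)) (at (\<phi> q)) a else 0)" for q f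
  have "E q \<in> tangent_space A q" for q
  proof (cases "q \<in> U")
    case True
    then show ?thesis
      by (simp add: tangent_space_def E_def smooth_fun_add smooth_fun_mult smooth_fun_cmult
          chart_derivation[OF c True, simplified] algebra_simps)
  next
    case False
    then have "E q = 0" using b(2) K by (auto simp: E_def fun_eq_iff)
    then show ?thesis by (simp add: tangent_space_zero)
  qed
  moreover have "smooth_fun A (\<lambda>q. E q f)" if "smooth_fun A f" for f
    using smooth_fun_cutoff[OF c chart_open[OF c] order_refl K b
        smooth_on_frechet_derivative[OF smooth_funD[OF that c]]] that
    by (simp add: E_def)
  ultimately have "E \<in> vector_fields A" by (simp add: vector_fields_def)
  then show ?thesis by (intro bexI[of _ E]) (auto simp: E_def)
qed

text \<open>The tangent space at \<open>p\<close> is the model space, realised by global vector fields. The map is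
  \<open>v \<mapsto> (v \<xi>\<^sub>b)\<^sub>b\<close> with \<open>\<xi>\<^sub>b\<close> the cut-off coordinates centred at \<open>p\<close>. Injectivity is Hadamard's lemma; coordinate
  fields show that it is onto. Cutting off with \<open>\<beta>\<close> itself, only normalised by \<open>\<beta> p = 1\<close>, is enough,
  since \<open>v\<close> is applied to \<open>\<beta>\<^sup>2 f\<close> and the terms with \<open>v (\<beta>\<^sup>2)\<close> cancel.\<close>

lemma ex_tangent_coordinates:
  shows "\<exists>L :: 'm tvec \<Rightarrow> 'e.
    (\<forall>u v. L (u + v) = L u + L v) \<and> (\<forall>c u. L (scale_tvec c u) = c *\<^sub>R L u) \<and>
    (\<forall>v\<in>tangent_space A p. L v = 0 \<longrightarrow> v = 0) \<and> (\<forall>a. \<exists>E\<in>vector_fields A. L (E p) = a)"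
proof -
  obtain U \<phi> where c: "(U, \<phi>) \<in> A" "p \<in> U" using ex_chart by blast
  note inv = chart_inv[OF c(1)]
  obtain r where r: "r > 0" "ball (\<phi> p) r \<subseteq> \<phi> ` U"
    using chart_image_open[OF c(1)] c(2) open_contains_ball by blast
  define O' where "O' = U \<inter> \<phi> -` ball (\<phi> p) r"
  have "continuous_on U \<phi>" using chart_homeomorphism[OF c(1)] by (simp add: homeomorphism_def)
  then have O: "open O'" "O' \<subseteq> U" "p \<in> O'"
    using r(1) c(2) continuous_open_preimage[OF _ chart_open[OF c(1)]] by (auto simp: O'_def)
  have img: "\<phi> ` O' = ball (\<phi> p) r" using r(2) by (auto simp: O'_def)
  obtain \<beta> K where b: "smooth_fun A \<beta>" "closed K" "K \<subseteq> O'" "\<And>q. q \<notin> K \<Longrightarrow> \<beta> q = 0" "\<beta> p = 1"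
    using ex_bump_in_chart[OF c(1) O] by blast
  define \<xi> where "\<xi> i q = \<beta> q * ((\<phi> q - \<phi> p) \<bullet> i)" for i q
  have lin: "smooth_on (\<phi> ` O') (\<lambda>x. (x - \<phi> p) \<bullet> i)" for i
    using smooth_on_add[OF _ smooth_on_bounded_linear[OF bounded_linear_inner_left _ smooth_on_ident]
        smooth_on_const[of _ "- (\<phi> p \<bullet> i)"], of "\<phi> ` O'" i] chart_image_open_subset[OF c(1) O(1,2)]
    by (simp add: inner_diff_left)
  have \<xi>: "smooth_fun A (\<xi> i)" for i
    unfolding \<xi>_def using smooth_fun_cutoff[OF c(1) O(1,2) b(2,3,1,4) lin] by simp
  define L where "L v = (\<Sum>i\<in>Basis. v (\<xi> i) *\<^sub>R i)" for v :: "'m tvec"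
  have comp: "L v \<bullet> i = v (\<xi> i)" if "i \<in> Basis" for v i
    using that by (simp add: L_def inner_sum_left inner_Basis if_distrib sum.delta cong: if_cong)
  have "v = 0" if v: "v \<in> tangent_space A p" and L0: "L v = 0" for v
  proof
    fix f
    show "v f = 0 f"
    proof (cases "smooth_fun A f")
      case True
      have "smooth_on (ball (\<phi> p) r) (\<lambda>x. f (inv_into U \<phi> x))"
        using smooth_on_subset[OF smooth_funD[OF True c(1)] r(2)] .
      from hadamard[OF this, unfolded inv[OF c(2)]] obtain h where h: "\<And>i. smooth_on (ball (\<phi> p) r) (h i)"
        and fh: "\<And>x. x \<in> ball (\<phi> p) r \<Longrightarrow> f (inv_into U \<phi> x) = f p + (\<Sum>i\<in>Basis. ((x - \<phi> p) \<bullet> i) * h i x)"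
        by blast
      define H where "H i q = \<beta> q * h i (\<phi> q)" for i q
      have H: "smooth_fun A (H i)" for i
        unfolding H_def using smooth_fun_cutoff[OF c(1) O(1,2) b(2,3,1,4)] h img by simp
      \<comment> \<open>one factor \<open>\<beta>\<close> is for the coordinate, the other for the quotient, which is smooth only near \<open>p\<close>\<close>
      have eq: "\<beta> * \<beta> * f = (\<lambda>q. f p * (\<beta> * \<beta>) q) + (\<Sum>i\<in>Basis. \<xi> i * H i)"
      proof
        fix q
        show "(\<beta> * \<beta> * f) q = ((\<lambda>q. f p * (\<beta> * \<beta>) q) + (\<Sum>i\<in>Basis. \<xi> i * H i)) q"
        proof (cases "q \<in> K")
          case True
          then have q: "q \<in> U" "\<phi> q \<in> ball (\<phi> p) r" using b(3) by (auto simp: O'_def)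
          show ?thesis
            using fh[OF q(2)] inv[OF q(1)]
            by (simp add: sum_fun_apply \<xi>_def H_def sum_distrib_left algebra_simps)
        qed (simp add: b(4) sum_fun_apply \<xi>_def)
      qed
      have "v (\<beta> * \<beta> * f) = v f + f p * v (\<beta> * \<beta>)"
        using tangent_mult[OF v smooth_fun_mult[OF b(1) b(1)] True] b(5) by simp
      moreover have "v ((\<lambda>q. f p * (\<beta> * \<beta>) q) + (\<Sum>i\<in>Basis. \<xi> i * H i))
          = f p * v (\<beta> * \<beta>) + (\<Sum>i\<in>Basis. v (\<xi> i * H i))"
        using v b(1) \<xi> H
        by (simp add: tangent_add tangent_cmult tangent_sum smooth_fun_mult smooth_fun_cmult
            smooth_fun_sum del: times_fun_apply)
      moreover have "v (\<xi> i * H i) = 0" if "i \<in> Basis" for i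
        using tangent_mult[OF v \<xi> H, of i i] comp[OF that, of v] L0 by (simp add: \<xi>_def)
      ultimately show ?thesis using eq by simp
    qed (simp add: tangent_nonsmooth[OF v])
  qed
  moreover have "\<exists>E\<in>vector_fields A. L (E p) = a" for a
  proof -
    obtain E where E: "E \<in> vector_fields A" "\<And>q f. smooth_fun A f \<Longrightarrow>
        E q f = \<beta> q * frechet_derivative (\<lambda>x. f (inv_into U \<phi> x)) (at (\<phi> q)) a"
      using ex_coordinate_field[OF c(1) b(2) _ b(1,4), of a] b(3) O(2) by blast
    have "E p (\<xi> i) = a \<bullet> i" for i
    proof -
      have pU: "\<phi> p \<in> \<phi> ` U" using c(2) by simp
      have "((\<lambda>x. \<beta> (inv_into U \<phi> x) * ((x - \<phi> p) \<bullet> i)) has_derivative (\<lambda>a. a \<bullet> i)) (at (\<phi> p))"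
        by (rule has_derivative_eq_rhs[OF has_derivative_mult[OF
              smooth_on_has_derivative[OF smooth_funD[OF b(1) c(1)] pU]
              bounded_linear.has_derivative[OF bounded_linear_inner_left
                has_derivative_diff[OF has_derivative_ident has_derivative_const]]]])
          (auto simp: inv c(2) b(5))
      then have "((\<lambda>x. \<xi> i (inv_into U \<phi> x)) has_derivative (\<lambda>a. a \<bullet> i)) (at (\<phi> p))"
        by (rule has_derivative_transform_within_open[OF _ chart_image_open[OF c(1)] pU])
          (auto simp: \<xi>_def inv)
      then show ?thesis
        using E(2)[OF \<xi>, of p i] fun_cong[OF frechet_derivative_at, of _ _ _ a] b(5) by fastforce
    qed
    then have "L (E p) = a" by (simp add: L_def euclidean_representation)
    then show ?thesis using E(1) by blast
  qed
  moreover have "L (u + v) = L u + L v" "L (scale_tvec c u) = c *\<^sub>R L u" for u v c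
    by (simp_all add: L_def scaleR_add_left sum.distrib scaleR_sum_right)
  ultimately show ?thesis by blast
qed

end

section \<open>Vector fields and adapted orthonormal frames\<close>

lemma scale_tvec_minus1: "scale_tvec (- 1) u = - u"
  by (simp add: scale_tvec_def fun_Compl_def)

context smooth_manifold
begin

lemma vector_fieldsD:
  assumes "X \<in> vector_fields A"
  shows field_tangent: "X p \<in> tangent_space A p"
    and field_smooth: "smooth_fun A f \<Longrightarrow> smooth_fun A (\<lambda>p. X p f)"
  using assms by (auto simp: vector_fields_def)

lemma vector_fields_add: "X \<in> vector_fields A \<Longrightarrow> Y \<in> vector_fields A \<Longrightarrow> X + Y \<in> vector_fields A"
  using smooth_fun_add[of "\<lambda>p. X p f" "\<lambda>p. Y p f" for f, unfolded plus_fun_def]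
  by (simp add: vector_fields_def tangent_space_add)

lemma vector_fields_scale:
  "smooth_fun A h \<Longrightarrow> X \<in> vector_fields A \<Longrightarrow> scale_field h X \<in> vector_fields A"
  using smooth_fun_mult[of h "\<lambda>p. X p f" for f, unfolded times_fun_def]
  by (simp add: vector_fields_def tangent_space_scale)

lemma vector_fields_zero: "0 \<in> vector_fields A"
  using smooth_fun_const[of 0] by (simp add: vector_fields_def tangent_space_zero)

lemma field_minus_eq: "- X = scale_field (\<lambda>_. - 1) X"
  by (simp add: fun_eq_iff)

lemma vector_fields_minus: "X \<in> vector_fields A \<Longrightarrow> - X \<in> vector_fields A"
  unfolding field_minus_eq by (intro vector_fields_scale smooth_fun_const)

lemma vector_fields_diff: "X \<in> vector_fields A \<Longrightarrow> Y \<in> vector_fields A \<Longrightarrow> X - Y \<in> vector_fields A"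
  using vector_fields_add[OF _ vector_fields_minus, of X Y] by simp

lemma vector_fields_sum:
  "(\<And>i. i \<in> I \<Longrightarrow> X i \<in> vector_fields A) \<Longrightarrow> (\<Sum>i\<in>I. X i) \<in> vector_fields A"
  by (induction I rule: infinite_finite_induct) (auto intro: vector_fields_zero vector_fields_add)

end

locale riemannian_manifold = smooth_manifold A
  for A :: "('m::t2_space, 'e::euclidean_space) atlas" +
  fixes g :: "'m metric_tensor"
  assumes riemannian_metric: "riemannian_metric A g"
begin

lemma metric:
  assumes "u \<in> tangent_space A p" "v \<in> tangent_space A p"
  shows metric_sym: "g p u v = g p v u"
    and metric_scale_left: "g p (scale_tvec c u) v = c * g p u v"
    and metric_add_left: "w \<in> tangent_space A p \<Longrightarrow> g p (u + v) w = g p u w + g p v w"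
  using riemannian_metric assms by (auto simp: riemannian_metric_def)

lemma metric_pos: "u \<in> tangent_space A p \<Longrightarrow> u \<noteq> 0 \<Longrightarrow> g p u u > 0"
  using riemannian_metric by (simp add: riemannian_metric_def)

lemma metric_scale_right:
  "u \<in> tangent_space A p \<Longrightarrow> v \<in> tangent_space A p \<Longrightarrow> g p u (scale_tvec c v) = c * g p u v"
  using metric_sym[OF _ tangent_space_scale] metric_scale_left metric_sym by metis

lemma metric_zero_left: "u \<in> tangent_space A p \<Longrightarrow> g p 0 u = 0"
  using metric_scale_left[of u p u 0] by (simp add: scale_tvec_def zero_fun_def)

lemma metric_zero_right: "u \<in> tangent_space A p \<Longrightarrow> g p u 0 = 0"
  using metric_zero_left metric_sym[OF tangent_space_zero] by metis

lemma metric_minus_left: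
  "u \<in> tangent_space A p \<Longrightarrow> v \<in> tangent_space A p \<Longrightarrow> g p (- u) v = - g p u v"
  using metric_scale_left[of u p v "- 1"] by (simp add: scale_tvec_minus1)

lemma metric_diff_left:
  "u \<in> tangent_space A p \<Longrightarrow> v \<in> tangent_space A p \<Longrightarrow> w \<in> tangent_space A p \<Longrightarrow>
    g p (u - v) w = g p u w - g p v w"
  using metric_add_left[OF _ tangent_space_minus, of u p v w] by (simp add: metric_minus_left)

lemma metric_sum_left:
  "(\<And>i. i \<in> I \<Longrightarrow> u i \<in> tangent_space A p) \<Longrightarrow> w \<in> tangent_space A p \<Longrightarrow>
    g p (\<Sum>i\<in>I. u i) w = (\<Sum>i\<in>I. g p (u i) w)"
  by (induction I rule: infinite_finite_induct)
    (auto simp: metric_zero_left metric_add_left tangent_space_sum)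

lemma metric_nonneg: "u \<in> tangent_space A p \<Longrightarrow> g p u u \<ge> 0"
  using metric_pos[of u p] metric_zero_left[OF tangent_space_zero, of p] by (cases "u = 0") force+

lemma metric_eq_0_iff: "u \<in> tangent_space A p \<Longrightarrow> g p u u = 0 \<longleftrightarrow> u = 0"
  using metric_pos[of u p] metric_zero_left[OF tangent_space_zero, of p] by force

text \<open>Orthogonality gives independence, and the coordinate map carries it to the model space, where the
  dimension is known.\<close>

lemma orthogonal_family_card:
  assumes w: "\<And>i. i < m \<Longrightarrow> w i \<in> tangent_space A p"
    and ne: "\<And>i. i < m \<Longrightarrow> w i \<noteq> 0"
    and orth: "\<And>i j. i < m \<Longrightarrow> j < m \<Longrightarrow> i \<noteq> j \<Longrightarrow> g p (w i) (w j) = 0"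
  shows "m \<le> DIM('e)"
proof -
  obtain L :: "'m tvec \<Rightarrow> 'e" where L: "\<And>u v. L (u + v) = L u + L v"
    "\<And>c u. L (scale_tvec c u) = c *\<^sub>R L u" "\<And>v. v \<in> tangent_space A p \<Longrightarrow> L v = 0 \<Longrightarrow> v = 0"
    using ex_tangent_coordinates[of p] by blast
  have L0: "L 0 = 0" using L(1)[of 0 0] by simp
  have Lsum: "L (\<Sum>i\<in>I. u i) = (\<Sum>i\<in>I. L (u i))" for I and u :: "nat \<Rightarrow> 'm tvec"
    using sum_comp_morphism[of L u I, OF L0 L(1)] by (simp add: o_def)
  have indep: "c j = 0" if "(\<Sum>i<m. c i *\<^sub>R L (w i)) = 0" "j < m" for c j
  proof -
    let ?s = "\<Sum>i<m. scale_tvec (c i) (w i)"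
    have s: "?s \<in> tangent_space A p" using w by (intro tangent_space_sum tangent_space_scale) auto
    have "L ?s = 0" using that(1) by (simp add: Lsum L(2))
    then have "?s = 0" using L(3) s by blast
    then have "0 = g p ?s (w j)" using metric_zero_left w that(2) by simp
    also have "\<dots> = (\<Sum>i<m. c i * g p (w i) (w j))"
      using w that(2) by (subst metric_sum_left) (auto simp: tangent_space_scale metric_scale_left)
    also have "\<dots> = (\<Sum>i<m. if i = j then c i * g p (w j) (w j) else 0)"
      using orth that(2) by (intro sum.cong) auto
    also have "\<dots> = c j * g p (w j) (w j)" using that(2) by simp
    finally show ?thesis using metric_pos[OF w ne, OF that(2) that(2)] by simp
  qed
  have inj: "inj_on (\<lambda>i. L (w i)) {..<m}"
  proof (rule inj_onI, rule ccontr)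
    fix i j assume ij: "i \<in> {..<m}" "j \<in> {..<m}" "L (w i) = L (w j)" "i \<noteq> j"
    let ?c = "\<lambda>k. (if k = i then 1 else 0) - (if k = j then 1 else 0) :: real"
    have "(\<Sum>k<m. ?c k *\<^sub>R L (w k)) = 0"
      using ij by (simp add: scaleR_left_diff_distrib sum_subtractf if_distrib[of "\<lambda>x. x *\<^sub>R _"] cong: if_cong)
    then have "?c i = 0" using indep[of ?c i] ij by simp
    then show False using ij(4) by simp
  qed
  have "independent ((\<lambda>i. L (w i)) ` {..<m})"
  proof (rule independent_if_scalars_zero)
    fix f x assume "(\<Sum>x\<in>(\<lambda>i. L (w i)) ` {..<m}. f x *\<^sub>R x) = 0" "x \<in> (\<lambda>i. L (w i)) ` {..<m}"
    then show "f x = 0"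
      using indep[of "\<lambda>i. f (L (w i))"] by (auto simp: sum.reindex[OF inj])
  qed simp
  from independent_bound[OF this] show ?thesis using card_image[OF inj] by simp
qed

definition orthonormal_at :: "'m \<Rightarrow> nat \<Rightarrow> (nat \<Rightarrow> 'm tvec) \<Rightarrow> bool" where
  "orthonormal_at p m w \<longleftrightarrow> (\<forall>i<m. w i \<in> tangent_space A p) \<and>
     (\<forall>i<m. \<forall>j<m. g p (w i) (w j) = (if i = j then 1 else 0))"

lemma orthonormal_component_removed:
  assumes "orthonormal_at p m w" "v \<in> tangent_space A p" "j < m"
  shows "g p (v - (\<Sum>i<m. scale_tvec (g p v (w i)) (w i))) (w j) = 0"
proof -
  have w: "\<And>i. i < m \<Longrightarrow> w i \<in> tangent_space A p"
    and on: "\<And>i j. i < m \<Longrightarrow> j < m \<Longrightarrow> g p (w i) (w j) = (if i = j then 1 else 0)"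
    using assms(1) by (auto simp: orthonormal_at_def)
  have "g p (v - (\<Sum>i<m. scale_tvec (g p v (w i)) (w i))) (w j)
      = g p v (w j) - (\<Sum>i<m. g p v (w i) * g p (w i) (w j))"
    using w assms(2,3)
    by (subst metric_diff_left, (auto intro!: tangent_space_sum tangent_space_scale)[3])
      (subst metric_sum_left, auto simp: tangent_space_scale metric_scale_left)
  also have "(\<Sum>i<m. g p v (w i) * g p (w i) (w j)) = (\<Sum>i<m. if i = j then g p v (w i) else 0)"
    using on assms(3) by (intro sum.cong) auto
  also have "g p v (w j) - \<dots> = 0" using assms(3) by simp
  finally show ?thesis .
qed

text \<open>Otherwise the remainder would be an additional vector orthogonal to the \<open>DIM('e)\<close> given ones.\<close>

lemma orthonormal_expansion:
  assumes on: "orthonormal_at p DIM('e) w" and v: "v \<in> tangent_space A p"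
  shows "v = (\<Sum>i<DIM('e). scale_tvec (g p v (w i)) (w i))"
proof (rule ccontr)
  let ?n = "DIM('e)"
  define u where "u = v - (\<Sum>i<?n. scale_tvec (g p v (w i)) (w i))"
  assume "v \<noteq> (\<Sum>i<?n. scale_tvec (g p v (w i)) (w i))"
  then have u0: "u \<noteq> 0" by (simp add: u_def)
  have w: "\<And>i. i < ?n \<Longrightarrow> w i \<in> tangent_space A p" using on by (simp add: orthonormal_at_def)
  have u: "u \<in> tangent_space A p"
    unfolding u_def using v w by (intro tangent_space_diff tangent_space_sum tangent_space_scale) auto
  have uw: "g p u (w j) = 0" "g p (w j) u = 0" if "j < ?n" for j
    using orthonormal_component_removed[OF on v that] metric_sym[OF u w[OF that]] by (simp_all add: u_def)
  have w0: "w i \<noteq> 0" if "i < ?n" for i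
    using metric_zero_left[OF tangent_space_zero, of p] on that by (force simp: orthonormal_at_def)
  have "Suc ?n \<le> DIM('e)"
    by (rule orthogonal_family_card[of "Suc ?n" "w(?n := u)" p])
      (use u u0 uw w w0 on in \<open>auto simp: orthonormal_at_def less_Suc_eq\<close>)
  then show False by simp
qed

lemma ex_field_outside_span:
  assumes "k < DIM('e)" "\<And>i. i < k \<Longrightarrow> w i \<in> tangent_space A p"
  shows "\<exists>E\<in>vector_fields A. \<forall>c. E p \<noteq> (\<Sum>i<k. scale_tvec (c i) (w i))"
proof -
  obtain L :: "'m tvec \<Rightarrow> 'e" where L: "\<And>u v. L (u + v) = L u + L v"
    "\<And>c u. L (scale_tvec c u) = c *\<^sub>R L u" "\<And>a. \<exists>E\<in>vector_fields A. L (E p) = a"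
    using ex_tangent_coordinates[of p] by blast
  have L0: "L 0 = 0" using L(1)[of 0 0] by simp
  have Lsum: "L (\<Sum>i\<in>I. u i) = (\<Sum>i\<in>I. L (u i))" for I and u :: "nat \<Rightarrow> 'm tvec"
    using sum_comp_morphism[of L u I, OF L0 L(1)] by (simp add: o_def)
  let ?S = "(\<lambda>i. L (w i)) ` {..<k}"
  have "dim ?S \<le> card ?S" by (rule dim_le_card') simp
  also have "\<dots> \<le> k" using card_image_le[of "{..<k}"] by simp
  finally have "dim ?S < DIM('e)" using assms(1) by simp
  then have "span ?S \<noteq> UNIV" using dim_span[of ?S] dim_UNIV by (metis less_irrefl)
  then obtain a where a: "a \<notin> span ?S" by blast
  obtain E where E: "E \<in> vector_fields A" "L (E p) = a" using L(3) by blast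
  have "L (\<Sum>i<k. scale_tvec (c i) (w i)) \<in> span ?S" for c
    unfolding Lsum L(2) by (intro span_sum span_scale span_base) auto
  then show ?thesis using E a by metis
qed

abbreviation G :: "'m vfield \<Rightarrow> 'm vfield \<Rightarrow> 'm \<Rightarrow> real" where "G \<equiv> metric_app g"

lemma smooth_fun_G: "X \<in> vector_fields A \<Longrightarrow> Y \<in> vector_fields A \<Longrightarrow> smooth_fun A (G X Y)"
  using riemannian_metric by (simp add: riemannian_metric_def)

text \<open>One Gram-Schmidt step. The orthogonalised field is nonzero only near \<open>p\<close>, and there its norm is bounded
  below, so it is normalised by the cut-off inverse square root.\<close>

lemma ex_unit_normal_field:
  assumes k: "k < DIM('e)" and e: "\<And>i. i < k \<Longrightarrow> e i \<in> vector_fields A"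
    and U: "open U" "p \<in> U" and on: "\<And>q. q \<in> U \<Longrightarrow> orthonormal_at q k (\<lambda>i. e i q)"
  shows "\<exists>W V. W \<in> vector_fields A \<and> open V \<and> p \<in> V \<and> V \<subseteq> U \<and>
    (\<forall>q\<in>V. g q (W q) (W q) = 1 \<and> (\<forall>i<k. g q (W q) (e i q) = 0))"
proof -
  obtain E where E: "E \<in> vector_fields A" "\<And>c. E p \<noteq> (\<Sum>i<k. scale_tvec (c i) (e i p))"
    using ex_field_outside_span[OF k, of "\<lambda>i. e i p" p] field_tangent[OF e] by blast
  define V where "V = E - (\<Sum>i<k. scale_field (G E (e i)) (e i))"
  have V: "V \<in> vector_fields A"
    unfolding V_def using E e
    by (intro vector_fields_diff vector_fields_sum vector_fields_scale smooth_fun_G) auto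
  have Vq: "V q = E q - (\<Sum>i<k. scale_tvec (g q (E q) (e i q)) (e i q))" for q
    by (simp add: V_def metric_app_def sum_fun_apply)
  have Vorth: "g q (V q) (e i q) = 0" if "q \<in> U" "i < k" for q i
    using orthonormal_component_removed[OF on[OF that(1)] field_tangent[OF E(1)] that(2)]
    by (simp add: Vq)
  define c where "c = G V V p"
  have "V p \<noteq> 0" using E(2)[of "\<lambda>i. g p (E p) (e i p)"] by (simp add: Vq)
  then have c: "c > 0" using metric_pos field_tangent[OF V] by (simp add: c_def metric_app_def)
  obtain r where r: "smooth_on UNIV r" "\<And>t. t \<ge> c / 2 \<Longrightarrow> (r t)\<^sup>2 * t = 1"
    using ex_smooth_inverse_sqrt[OF c] by blast
  define W where "W = scale_field (\<lambda>q. r (G V V q)) V"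
  have W: "W \<in> vector_fields A"
    unfolding W_def by (intro vector_fields_scale smooth_fun_compose[OF smooth_fun_G r(1)] V)
  let ?O = "U \<inter> (G V V) -` {c/2<..}"
  have O: "open ?O"
    using smooth_fun_continuous[OF smooth_fun_G[OF V V]] U(1)
    by (intro open_Int open_vimage open_greaterThan) auto
  have "g q (W q) (W q) = 1" if "q \<in> ?O" for q
  proof -
    have "g q (W q) (W q) = (r (G V V q))\<^sup>2 * G V V q"
      using field_tangent[OF V, of q]
      by (simp add: W_def metric_app_def metric_scale_left metric_scale_right tangent_space_scale
          power2_eq_square)
    then show ?thesis using r(2)[of "G V V q"] that by simp
  qed
  moreover have "g q (W q) (e i q) = 0" if "q \<in> ?O" "i < k" for q i
    using Vorth[of q i] that field_tangent[OF V, of q] field_tangent[OF e, of i q]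
    by (simp add: W_def metric_scale_left)
  moreover have "p \<in> ?O" using U(2) c by (simp add: c_def[symmetric])
  ultimately show ?thesis using W O by (intro exI[of _ W] exI[of _ ?O]) blast
qed

end

locale almost_hermitian_manifold = riemannian_manifold A g
  for A :: "('m::t2_space, 'e::euclidean_space) atlas" and g +
  fixes J :: "'m endo"
  assumes almost_complex: "almost_complex_structure A J"
    and J_orthogonal:
      "u \<in> tangent_space A p \<Longrightarrow> v \<in> tangent_space A p \<Longrightarrow> g p (J p u) (J p v) = g p u v"
begin

lemma J_props:
  assumes "u \<in> tangent_space A p"
  shows J_tangent: "J p u \<in> tangent_space A p"
    and J_add: "v \<in> tangent_space A p \<Longrightarrow> J p (u + v) = J p u + J p v"
    and J_scale: "J p (scale_tvec c u) = scale_tvec c (J p u)"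
    and J_J: "J p (J p u) = - u"
  using almost_complex assms by (auto simp: almost_complex_structure_def)

lemma J_skew:
  assumes "u \<in> tangent_space A p" "v \<in> tangent_space A p"
  shows "g p (J p u) v = - g p u (J p v)"
  using J_orthogonal[OF J_tangent[OF assms(1)] assms(2)] assms
  by (simp add: J_J metric_minus_left J_tangent)

abbreviation j :: "'m vfield \<Rightarrow> 'm vfield" where "j \<equiv> endo_app J"

lemma vector_fields_j: "X \<in> vector_fields A \<Longrightarrow> j X \<in> vector_fields A"
  using almost_complex by (simp add: almost_complex_structure_def)

text \<open>The span of the first \<open>2 k\<close> fields is invariant under \<open>J\<close>. So if \<open>W\<close> is a unit field orthogonal to them,
  then \<open>J W\<close> is orthogonal to them too, and to \<open>W\<close> because \<open>J\<close> is skew. The bound on \<open>k\<close> leaves room for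
  a dimension that is not known to be even.\<close>

lemma ex_partial_adapted_frame:
  assumes "2 * k \<le> DIM('e) + 1"
  shows "\<exists>e U. open U \<and> p \<in> U \<and> (\<forall>i<2*k. e i \<in> vector_fields A) \<and>
    (\<forall>q\<in>U. orthonormal_at q (2 * k) (\<lambda>i. e i q)) \<and> (\<forall>a<k. e (2 * a + 1) = j (e (2 * a)))"
  using assms
proof (induction k)
  case 0
  show ?case by (intro exI[of _ "\<lambda>_. 0"] exI[of _ UNIV]) (simp add: orthonormal_at_def)
next
  case (Suc k)
  then obtain e U where U: "open U" "p \<in> U" and e: "\<And>i. i < 2 * k \<Longrightarrow> e i \<in> vector_fields A"
    and on: "\<And>q. q \<in> U \<Longrightarrow> orthonormal_at q (2 * k) (\<lambda>i. e i q)"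
    and ej: "\<And>a. a < k \<Longrightarrow> e (2 * a + 1) = j (e (2 * a))"
    by auto
  obtain W V where W: "W \<in> vector_fields A" and V: "open V" "p \<in> V" "V \<subseteq> U"
    and W1: "\<And>q. q \<in> V \<Longrightarrow> g q (W q) (W q) = 1"
    and W0: "\<And>q i. q \<in> V \<Longrightarrow> i < 2 * k \<Longrightarrow> g q (W q) (e i q) = 0"
    using ex_unit_normal_field[OF _ e U on] Suc.prems by auto
  define e' where "e' = e(2 * k := W, 2 * k + 1 := j W)"
  have e': "e' i \<in> vector_fields A" if "i < 2 * Suc k" for i
    using that e W vector_fields_j[OF W] by (auto simp: e'_def less_Suc_eq)
  have e'j: "e' (2 * a + 1) = j (e' (2 * a))" if "a < Suc k" for a
    using that ej[of a] by (cases "a = k") (auto simp: e'_def)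
  have "orthonormal_at q (2 * Suc k) (\<lambda>i. e' i q)" if q: "q \<in> V" for q
  proof -
    have tW: "W q \<in> tangent_space A q" and te: "i < 2 * k \<Longrightarrow> e i q \<in> tangent_space A q" for i
      using field_tangent[OF W] field_tangent[OF e] by auto
    have tjW: "J q (W q) \<in> tangent_space A q" by (rule J_tangent[OF tW])
    have one: "g q (e i q) (e m q) = (if i = m then 1 else 0)" if "i < 2 * k" "m < 2 * k" for i m
      using on[of q] q V(3) that by (auto simp: orthonormal_at_def)
    have jW0: "g q (J q (W q)) (e i q) = 0" if i: "i < 2 * k" for i
    proof (cases "even i")
      case True
      then obtain a where a: "i = 2 * a" by blast
      then have "e (Suc i) = j (e i)" "Suc i < 2 * k" using ej[of a] i by auto
      then have "g q (W q) (J q (e i q)) = 0" using W0[OF q, of "Suc i"] by (simp add: endo_app_def)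
      then show ?thesis using J_skew[OF tW te[OF i]] by simp
    next
      case False
      then obtain a where a: "i = 2 * a + 1" using oddE by blast
      then have "e i = j (e (2 * a))" "2 * a < 2 * k" using ej[of a] i by auto
      then show ?thesis using J_orthogonal[OF tW te[of "2 * a"]] W0[OF q, of "2 * a"]
        by (simp add: endo_app_def)
    qed
    have jWW: "g q (J q (W q)) (W q) = 0"
      using J_skew[OF tW tW] metric_sym[OF tW tjW] by simp
    have jW1: "g q (J q (W q)) (J q (W q)) = 1" using J_orthogonal[OF tW tW] W1[OF q] by simp
    have eW: "g q (e i q) (W q) = 0" "g q (e i q) (J q (W q)) = 0" if "i < 2 * k" for i
      using W0[OF q that] jW0[OF that] metric_sym[OF te[OF that] tW] metric_sym[OF te[OF that] tjW]
      by simp_all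
    have WjW: "g q (W q) (J q (W q)) = 0" using jWW metric_sym[OF tW tjW] by simp
    show ?thesis
      unfolding orthonormal_at_def using field_tangent[OF e'] one W0[OF q] W1[OF q] jW0 jWW jW1 eW WjW
      by (auto simp: e'_def endo_app_def less_Suc_eq)
  qed
  then show ?case using V e' e'j by (intro exI[of _ e'] exI[of _ V]) auto
qed

lemma ex_adapted_frame: "\<exists>e. adapted_frame_at A J g p e"
proof -
  let ?k = "(DIM('e) + 1) div 2"
  obtain e U where U: "open U" "p \<in> U" and e: "\<And>i. i < 2 * ?k \<Longrightarrow> e i \<in> vector_fields A"
    and on: "\<And>q. q \<in> U \<Longrightarrow> orthonormal_at q (2 * ?k) (\<lambda>i. e i q)"
    and ej: "\<And>a. a < ?k \<Longrightarrow> e (2 * a + 1) = j (e (2 * a))"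
    using ex_partial_adapted_frame[of ?k p] by auto
  have n: "DIM('e) \<le> 2 * ?k" by simp
  have "orthonormal_frame_on A g U e"
    using n e on by (auto simp: orthonormal_frame_on_def orthonormal_at_def)
  moreover have "e (2 * a + 1) q = J q (e (2 * a) q)" if "2 * a + 1 < DIM('e)" for a q
    using ej[of a] that by (simp add: endo_app_def)
  ultimately show ?thesis using U by (auto simp: adapted_frame_at_def)
qed

lemma adapted_imp_orthonormal_frame: "adapted_frame_at A J g p e \<Longrightarrow> orthonormal_frame_at A g p e"
  by (auto simp: adapted_frame_at_def orthonormal_frame_at_def)

end

section \<open>Brackets, tensors and connections\<close>

context smooth_manifold
begin

lemma smooth_fun_deriv_along:
  "X \<in> vector_fields A \<Longrightarrow> smooth_fun A f \<Longrightarrow> smooth_fun A (deriv_along X f)"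
  by (simp add: deriv_along_def field_smooth)

lemma deriv_along_field:
  shows deriv_along_field_add: "deriv_along (X + Y) f = deriv_along X f + deriv_along Y f"
    and deriv_along_field_diff: "deriv_along (X - Y) f = deriv_along X f - deriv_along Y f"
    and deriv_along_field_scale: "deriv_along (scale_field h X) f = h * deriv_along X f"
  by (auto simp: deriv_along_def)

lemma deriv_along_fun:
  assumes "X \<in> vector_fields A" "smooth_fun A f"
  shows deriv_along_fun_add: "smooth_fun A h \<Longrightarrow> deriv_along X (f + h) = deriv_along X f + deriv_along X h"
    and deriv_along_fun_diff: "smooth_fun A h \<Longrightarrow> deriv_along X (f - h) = deriv_along X f - deriv_along X h"
    and deriv_along_fun_mult: "smooth_fun A h \<Longrightarrow> deriv_along X (f * h) = f * deriv_along X h + h * deriv_along X f"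
    and deriv_along_fun_cmult: "deriv_along X (\<lambda>q. c * f q) = (\<lambda>q. c * deriv_along X f q)"
  using assms(2) field_tangent[OF assms(1)]
  by (auto simp: deriv_along_def fun_eq_iff intro: tangent_add tangent_diff tangent_mult
      tangent_cmult)

lemma deriv_along_const: "X \<in> vector_fields A \<Longrightarrow> deriv_along X (\<lambda>_. c) = 0"
  using tangent_const[OF field_tangent, of X] by (auto simp: deriv_along_def)

lemma deriv_along_zero: "X \<in> vector_fields A \<Longrightarrow> deriv_along X 0 = 0"
  using deriv_along_const[of X 0] by (simp add: zero_fun_def)

lemma deriv_along_nonsmooth: "X \<in> vector_fields A \<Longrightarrow> \<not> smooth_fun A f \<Longrightarrow> deriv_along X f = 0"
  using tangent_nonsmooth[OF field_tangent, of X f] by (auto simp: deriv_along_def)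

lemma deriv_along_lie_bracket:
  "deriv_along (lie_bracket X Y) f = deriv_along X (deriv_along Y f) - deriv_along Y (deriv_along X f)"
  by (auto simp: deriv_along_def lie_bracket_def)

text \<open>Identities between brackets reduce to identities between iterated derivatives, on which the Leibniz
  rules can be used as rewrite rules.\<close>

lemma field_eqI:
  assumes "X \<in> vector_fields A" "Y \<in> vector_fields A"
    "\<And>f. smooth_fun A f \<Longrightarrow> deriv_along X f = deriv_along Y f"
  shows "X = Y"
proof (intro ext)
  fix p f
  show "X p f = Y p f"
    using assms(3)[of f] tangent_nonsmooth[OF field_tangent[OF assms(1)], of f p]
      tangent_nonsmooth[OF field_tangent[OF assms(2)], of f p]
    by (cases "smooth_fun A f") (auto simp: deriv_along_def dest: fun_cong)
qed

lemma vector_fields_lie_bracket: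
  assumes X: "X \<in> vector_fields A" and Y: "Y \<in> vector_fields A"
  shows "lie_bracket X Y \<in> vector_fields A"
proof -
  have eq: "lie_bracket X Y p f = deriv_along X (deriv_along Y f) p - deriv_along Y (deriv_along X f) p" for p f
    by (simp add: lie_bracket_def deriv_along_def)
  note s = smooth_fun_deriv_along[OF X] smooth_fun_deriv_along[OF Y]
  note d = deriv_along_fun[OF X] deriv_along_fun[OF Y]
  have "lie_bracket X Y p \<in> tangent_space A p" for p
    unfolding tangent_space_def mem_Collect_eq eq
    using X Y by (auto simp: deriv_along_nonsmooth deriv_along_zero d s smooth_fun_mult algebra_simps)
  moreover have "smooth_fun A (\<lambda>p. lie_bracket X Y p f)" if "smooth_fun A f" for f
    using smooth_fun_diff[OF s(1)[OF s(2)[OF that]] s(2)[OF s(1)[OF that]]]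
    by (simp add: eq fun_diff_def)
  ultimately show ?thesis by (simp add: vector_fields_def)
qed

lemmas vector_fields_closed = vector_fields_add vector_fields_diff vector_fields_minus
  vector_fields_scale vector_fields_lie_bracket vector_fields_zero

lemma lie_bracket_anticommute: "lie_bracket Y X = - lie_bracket X Y"
  by (simp add: lie_bracket_def fun_eq_iff)

lemma lie_bracket_add_left:
  assumes "X \<in> vector_fields A" "X' \<in> vector_fields A" "Y \<in> vector_fields A"
  shows "lie_bracket (X + X') Y = lie_bracket X Y + lie_bracket X' Y"
  by (rule field_eqI) (use assms in \<open>simp_all add: vector_fields_closed deriv_along_lie_bracket
    deriv_along_field deriv_along_fun smooth_fun_deriv_along algebra_simps\<close>)

lemma lie_bracket_scale_left:
  assumes "smooth_fun A h" "X \<in> vector_fields A" "Y \<in> vector_fields A"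
  shows "lie_bracket (scale_field h X) Y = scale_field h (lie_bracket X Y) - scale_field (deriv_along Y h) X"
  by (rule field_eqI) (use assms in \<open>simp_all add: vector_fields_closed deriv_along_lie_bracket
    deriv_along_field deriv_along_fun smooth_fun_deriv_along algebra_simps\<close>)

lemma jacobi:
  assumes "X \<in> vector_fields A" "Y \<in> vector_fields A" "Z \<in> vector_fields A"
  shows "lie_bracket X (lie_bracket Y Z) + lie_bracket Y (lie_bracket Z X) + lie_bracket Z (lie_bracket X Y) = 0"
proof (rule field_eqI)
  fix f assume "smooth_fun A f"
  moreover have "deriv_along 0 f = 0" by (auto simp: deriv_along_def)
  ultimately show "deriv_along (lie_bracket X (lie_bracket Y Z) + lie_bracket Y (lie_bracket Z X)
      + lie_bracket Z (lie_bracket X Y)) f = deriv_along 0 f"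
    using assms by (simp add: deriv_along_lie_bracket deriv_along_field deriv_along_fun
        smooth_fun_deriv_along)
qed (use assms in \<open>simp_all add: vector_fields_closed\<close>)

text \<open>Functionals of this kind depend only on the value of the field at \<open>p\<close>; \<open>tensorial_expansion\<close> below
  gives this in the form of an expansion in a frame.\<close>

definition tensorial_at :: "'m \<Rightarrow> ('m vfield \<Rightarrow> real) \<Rightarrow> bool" where
  "tensorial_at p b \<longleftrightarrow>
     (\<forall>X\<in>vector_fields A. \<forall>Y\<in>vector_fields A. b (X + Y) = b X + b Y) \<and>
     (\<forall>X\<in>vector_fields A. \<forall>f. smooth_fun A f \<longrightarrow> b (scale_field f X) = f p * b X)"

lemma tensorial_at_sum:
  assumes "tensorial_at p b" "\<And>i. i \<in> I \<Longrightarrow> X i \<in> vector_fields A"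
  shows "b (\<Sum>i\<in>I. X i) = (\<Sum>i\<in>I. b (X i))"
proof -
  have "scale_field 0 0 = (0 :: 'm vfield)" by (auto simp: fun_eq_iff)
  then have "b 0 = 0"
    using assms(1) vector_fields_zero smooth_fun_zero unfolding tensorial_at_def
    by (metis mult_zero_left zero_fun_apply)
  then show ?thesis
    using assms(1,2) by (induction I rule: infinite_finite_induct)
      (simp_all add: tensorial_at_def vector_fields_sum)
qed

end

context riemannian_manifold
begin

lemma G_add_left: "X \<in> vector_fields A \<Longrightarrow> Y \<in> vector_fields A \<Longrightarrow> Z \<in> vector_fields A \<Longrightarrow>
    G (X + Y) Z = G X Z + G Y Z"
  by (auto simp: metric_app_def metric_add_left field_tangent)

lemma G_sym: "X \<in> vector_fields A \<Longrightarrow> Y \<in> vector_fields A \<Longrightarrow> G X Y = G Y X"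
  by (auto simp: metric_app_def metric_sym field_tangent)

lemma G_add_right: "X \<in> vector_fields A \<Longrightarrow> Y \<in> vector_fields A \<Longrightarrow> Z \<in> vector_fields A \<Longrightarrow>
    G X (Y + Z) = G X Y + G X Z"
  using G_add_left[of Y Z X] G_sym vector_fields_add by metis

lemma G_scale_left: "X \<in> vector_fields A \<Longrightarrow> Y \<in> vector_fields A \<Longrightarrow>
    G (scale_field h X) Y = h * G X Y"
  by (auto simp: metric_app_def metric_scale_left field_tangent)

lemma G_scale_right: "X \<in> vector_fields A \<Longrightarrow> Y \<in> vector_fields A \<Longrightarrow>
    G X (scale_field h Y) = h * G X Y"
  by (auto simp: metric_app_def metric_scale_right field_tangent)

lemma G_minus_left: "X \<in> vector_fields A \<Longrightarrow> Y \<in> vector_fields A \<Longrightarrow> G (- X) Y = - G X Y"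
  by (auto simp: metric_app_def metric_minus_left field_tangent)

lemma G_minus_right: "X \<in> vector_fields A \<Longrightarrow> Y \<in> vector_fields A \<Longrightarrow> G X (- Y) = - G X Y"
  using G_minus_left[of Y X] G_sym vector_fields_minus by metis

lemma G_diff_left: "X \<in> vector_fields A \<Longrightarrow> Y \<in> vector_fields A \<Longrightarrow> Z \<in> vector_fields A \<Longrightarrow>
    G (X - Y) Z = G X Z - G Y Z"
  by (auto simp: metric_app_def metric_diff_left field_tangent)

lemma G_diff_right: "X \<in> vector_fields A \<Longrightarrow> Y \<in> vector_fields A \<Longrightarrow> Z \<in> vector_fields A \<Longrightarrow>
    G X (Y - Z) = G X Y - G X Z"
  using G_diff_left[of Y Z X] G_sym vector_fields_diff by metis

lemma G_zero: "X \<in> vector_fields A \<Longrightarrow> G 0 X = 0" "X \<in> vector_fields A \<Longrightarrow> G X 0 = 0"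
  by (auto simp: metric_app_def metric_zero_left metric_zero_right field_tangent)

lemmas G_bilinear = G_add_left G_add_right G_diff_left G_diff_right G_minus_left G_minus_right
  G_scale_left G_scale_right G_zero

lemma G_nonneg: "X \<in> vector_fields A \<Longrightarrow> G X X p \<ge> 0"
  by (simp add: metric_app_def metric_nonneg field_tangent)

lemma G_eq_0_iff: "X \<in> vector_fields A \<Longrightarrow> G X X p = 0 \<longleftrightarrow> X p = 0"
  by (simp add: metric_app_def metric_eq_0_iff field_tangent)

lemma field_eq_0I:
  assumes "X \<in> vector_fields A" "\<And>Y. Y \<in> vector_fields A \<Longrightarrow> G X Y = 0"
  shows "X = 0"
proof
  show "X p = 0 p" for p using G_eq_0_iff[OF assms(1), of p] assms(2)[OF assms(1)] by simp
qed

lemma orthonormal_frameD: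
  assumes "orthonormal_frame_at A g p e"
  shows frame_field: "i < DIM('e) \<Longrightarrow> e i \<in> vector_fields A"
    and frame_orthonormal: "i < DIM('e) \<Longrightarrow> k < DIM('e) \<Longrightarrow> G (e i) (e k) p = (if i = k then 1 else 0)"
  using assms by (auto simp: orthonormal_frame_at_def orthonormal_frame_on_def metric_app_def)

text \<open>A frame represents \<open>X\<close> only near \<open>p\<close>, whereas \<open>b\<close> is defined on global fields. After
  multiplication by a bump function the expansion holds everywhere, and the factor \<open>\<beta> p = 1\<close> disappears again.\<close>

lemma tensorial_expansion:
  assumes b: "tensorial_at p b" and e: "orthonormal_frame_at A g p e" and X: "X \<in> vector_fields A"
  shows "b X = (\<Sum>i<DIM('e). G X (e i) p * b (e i))"
proof -
  obtain U where U: "open U" "p \<in> U" "orthonormal_frame_on A g U e"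
    using e by (auto simp: orthonormal_frame_at_def)
  obtain \<beta> where \<beta>: "smooth_fun A \<beta>" "\<And>q. q \<notin> U \<Longrightarrow> \<beta> q = 0" "\<beta> p = 1"
    using ex_bump_in_open[OF U(1,2)] by blast
  note ei = frame_field[OF e]
  have "scale_field \<beta> X q = (\<Sum>i<DIM('e). scale_field (\<beta> * G X (e i)) (e i)) q" for q
  proof (cases "q \<in> U")
    case True
    have "orthonormal_at q DIM('e) (\<lambda>i. e i q)"
      using U(3) True ei field_tangent by (auto simp: orthonormal_frame_on_def orthonormal_at_def)
    from orthonormal_expansion[OF this field_tangent[OF X]]
    have "X q h = (\<Sum>i<DIM('e). G X (e i) q * e i q h)" for h
      by (metis (mono_tags, lifting) metric_app_def scale_tvec_apply sum.cong sum_fun_apply)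
    then show ?thesis
      by (simp add: fun_eq_iff sum_fun_apply sum_distrib_left mult.assoc)
  qed (simp add: \<beta>(2) fun_eq_iff sum_fun_apply)
  then have "scale_field \<beta> X = (\<Sum>i<DIM('e). scale_field (\<beta> * G X (e i)) (e i))" by blast
  then have "b (scale_field \<beta> X) = (\<Sum>i<DIM('e). b (scale_field (\<beta> * G X (e i)) (e i)))"
    using ei X \<beta>(1)
    by (simp only:) (rule tensorial_at_sum[OF b], simp add: vector_fields_scale smooth_fun_mult smooth_fun_G)
  then show ?thesis
    using b ei X \<beta> by (simp add: tensorial_at_def smooth_fun_mult smooth_fun_G)
qed

lemma tensorial_G:
  "Y \<in> vector_fields A \<Longrightarrow> tensorial_at p (\<lambda>X. G X Y p)"
  by (simp add: tensorial_at_def G_add_left G_scale_left)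

text \<open>Expanding \<open>f\<^sub>i\<close> in the frame \<open>e\<close> reduces the claim to
  \<open>\<Sum>\<^sub>i g (f\<^sub>i, e\<^sub>k) g (f\<^sub>i, e\<^sub>l) = g (e\<^sub>k, e\<^sub>l)\<close>, which is the expansion of \<open>e\<^sub>l\<close> in the frame \<open>f\<close>.\<close>

lemma trace_frame_independent:
  assumes b: "\<And>Y. Y \<in> vector_fields A \<Longrightarrow> tensorial_at p (\<lambda>X. b X Y)"
    "\<And>X. X \<in> vector_fields A \<Longrightarrow> tensorial_at p (b X)"
    and e: "orthonormal_frame_at A g p e" and f: "orthonormal_frame_at A g p f"
  shows "(\<Sum>i<DIM('e). b (f i) (f i)) = (\<Sum>i<DIM('e). b (e i) (e i))"
proof -
  let ?n = "DIM('e)"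
  note ei = frame_field[OF e] and fi = frame_field[OF f]
  have "b (f i) (f i) = (\<Sum>k<?n. \<Sum>l<?n. G (f i) (e k) p * G (f i) (e l) p * b (e k) (e l))"
    if i: "i < ?n" for i
  proof -
    have "b (f i) (f i) = (\<Sum>k<?n. G (f i) (e k) p * b (e k) (f i))"
      by (rule tensorial_expansion[OF b(1)[OF fi[OF i]] e fi[OF i]])
    also have "\<dots> = (\<Sum>k<?n. G (f i) (e k) p * (\<Sum>l<?n. G (f i) (e l) p * b (e k) (e l)))"
      using tensorial_expansion[OF b(2)[OF ei] e fi[OF i]] by simp
    finally show ?thesis by (simp add: sum_distrib_left mult.assoc)
  qed
  then have "(\<Sum>i<?n. b (f i) (f i))
      = (\<Sum>i<?n. \<Sum>k<?n. \<Sum>l<?n. G (f i) (e k) p * G (f i) (e l) p * b (e k) (e l))" by simp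
  also have "\<dots> = (\<Sum>k<?n. \<Sum>l<?n. \<Sum>i<?n. G (f i) (e k) p * G (f i) (e l) p * b (e k) (e l))"
    by (subst sum.swap) (intro sum.cong refl sum.swap)
  also have "\<dots> = (\<Sum>k<?n. \<Sum>l<?n. (if k = l then 1 else 0) * b (e k) (e l))"
  proof (intro sum.cong refl)
    fix k l assume kl: "k \<in> {..<?n}" "l \<in> {..<?n}"
    have "(\<Sum>i<?n. G (f i) (e k) p * G (f i) (e l) p) = G (e k) (e l) p"
      using tensorial_expansion[OF tensorial_G[OF ei] f ei, of l k] kl G_sym[OF ei fi, of k] by simp
    then show "(\<Sum>i<?n. G (f i) (e k) p * G (f i) (e l) p * b (e k) (e l))
        = (if k = l then 1 else 0) * b (e k) (e l)"
      using frame_orthonormal[OF e] kl by (simp flip: sum_distrib_right)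
  qed
  also have "\<dots> = (\<Sum>k<?n. b (e k) (e k))"
    by (simp add: if_distrib[of "\<lambda>x. x * _"] cong: if_cong)
  finally show ?thesis .
qed

end

locale connection = smooth_manifold A
  for A :: "('m::t2_space, 'e::euclidean_space) atlas" +
  fixes D :: "'m connection"
  assumes is_connection: "is_connection A D"
begin

lemma
  assumes "X \<in> vector_fields A" "Y \<in> vector_fields A"
  shows closed: "D X Y \<in> vector_fields A"
    and add_left: "Z \<in> vector_fields A \<Longrightarrow> D (X + Y) Z = D X Z + D Y Z"
    and add_right: "Z \<in> vector_fields A \<Longrightarrow> D Z (X + Y) = D Z X + D Z Y"
    and scale_left: "smooth_fun A f \<Longrightarrow> D (scale_field f X) Y = scale_field f (D X Y)"
    and leibniz: "smooth_fun A f \<Longrightarrow>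
      D X (scale_field f Y) = scale_field (deriv_along X f) Y + scale_field f (D X Y)"
  using is_connection assms by (auto simp: is_connection_def)

lemma minus_left: "X \<in> vector_fields A \<Longrightarrow> Y \<in> vector_fields A \<Longrightarrow> D (- X) Y = - D X Y"
  by (simp add: field_minus_eq[of X] field_minus_eq[of "D X Y"] scale_left smooth_fun_const)

lemma minus_right: "X \<in> vector_fields A \<Longrightarrow> Y \<in> vector_fields A \<Longrightarrow> D X (- Y) = - D X Y"
  by (simp add: field_minus_eq[of Y] field_minus_eq[of "D X Y"] leibniz smooth_fun_const
      deriv_along_const fun_eq_iff)

lemma diff_left: "X \<in> vector_fields A \<Longrightarrow> Y \<in> vector_fields A \<Longrightarrow> Z \<in> vector_fields A \<Longrightarrow>
    D (X - Y) Z = D X Z - D Y Z"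
  using add_left[of X "- Y" Z] by (simp add: vector_fields_minus minus_left)

lemma diff_right: "X \<in> vector_fields A \<Longrightarrow> Y \<in> vector_fields A \<Longrightarrow> Z \<in> vector_fields A \<Longrightarrow>
    D Z (X - Y) = D Z X - D Z Y"
  using add_right[of X "- Y" Z] by (simp add: vector_fields_minus minus_right)

lemma zero_right: "X \<in> vector_fields A \<Longrightarrow> D X 0 = 0"
  using diff_right[of 0 0 X] vector_fields_zero by simp

lemma curvature_closed:
  "X \<in> vector_fields A \<Longrightarrow> Y \<in> vector_fields A \<Longrightarrow> Z \<in> vector_fields A \<Longrightarrow> curvature D X Y Z \<in> vector_fields A"
  by (simp add: curvature_def closed vector_fields_closed)

lemma curvature_anticommute:
  "X \<in> vector_fields A \<Longrightarrow> Y \<in> vector_fields A \<Longrightarrow> Z \<in> vector_fields A \<Longrightarrow>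
    curvature D Y X Z = - curvature D X Y Z"
  by (simp add: curvature_def lie_bracket_anticommute[of Y X] minus_left vector_fields_closed)

lemma curvature_add_1:
  "X \<in> vector_fields A \<Longrightarrow> X' \<in> vector_fields A \<Longrightarrow> Y \<in> vector_fields A \<Longrightarrow> Z \<in> vector_fields A \<Longrightarrow>
    curvature D (X + X') Y Z = curvature D X Y Z + curvature D X' Y Z"
  by (simp add: curvature_def lie_bracket_add_left add_left add_right closed vector_fields_closed)

lemma curvature_add_3:
  "X \<in> vector_fields A \<Longrightarrow> Y \<in> vector_fields A \<Longrightarrow> Z \<in> vector_fields A \<Longrightarrow> Z' \<in> vector_fields A \<Longrightarrow>
    curvature D X Y (Z + Z') = curvature D X Y Z + curvature D X Y Z'"
  by (simp add: curvature_def add_right closed vector_fields_closed)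

lemma curvature_scale_1:
  "smooth_fun A h \<Longrightarrow> X \<in> vector_fields A \<Longrightarrow> Y \<in> vector_fields A \<Longrightarrow> Z \<in> vector_fields A \<Longrightarrow>
    curvature D (scale_field h X) Y Z = scale_field h (curvature D X Y Z)"
  by (simp add: curvature_def lie_bracket_scale_left scale_left leibniz diff_left closed
      vector_fields_closed smooth_fun_deriv_along) (simp add: fun_eq_iff algebra_simps)

lemma curvature_scale_3:
  "smooth_fun A h \<Longrightarrow> X \<in> vector_fields A \<Longrightarrow> Y \<in> vector_fields A \<Longrightarrow> Z \<in> vector_fields A \<Longrightarrow>
    curvature D X Y (scale_field h Z) = scale_field h (curvature D X Y Z)"
  by (simp add: curvature_def leibniz add_right closed vector_fields_closed smooth_fun_deriv_along
      deriv_along_lie_bracket) (simp add: fun_eq_iff algebra_simps)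

lemma curvature_add_2:
  "X \<in> vector_fields A \<Longrightarrow> Y \<in> vector_fields A \<Longrightarrow> Y' \<in> vector_fields A \<Longrightarrow> Z \<in> vector_fields A \<Longrightarrow>
    curvature D X (Y + Y') Z = curvature D X Y Z + curvature D X Y' Z"
  by (simp add: curvature_anticommute[of _ X] curvature_add_1 vector_fields_add)

lemma curvature_scale_2:
  "smooth_fun A h \<Longrightarrow> X \<in> vector_fields A \<Longrightarrow> Y \<in> vector_fields A \<Longrightarrow> Z \<in> vector_fields A \<Longrightarrow>
    curvature D X (scale_field h Y) Z = scale_field h (curvature D X Y Z)"
  by (simp add: curvature_anticommute[of _ X] curvature_scale_1 vector_fields_scale)
    (simp add: fun_eq_iff)

text \<open>The torsion terms are kept unexpanded: no covariant derivative of the torsion is introduced, and the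
  Jacobi identity removes the iterated brackets.\<close>

lemma first_bianchi:
  assumes "X \<in> vector_fields A" "Y \<in> vector_fields A" "Z \<in> vector_fields A"
  shows "curvature D X Y Z + curvature D Y Z X + curvature D Z X Y =
    D X (torsion D Y Z) + torsion D X (lie_bracket Y Z) +
    (D Y (torsion D Z X) + torsion D Y (lie_bracket Z X)) +
    (D Z (torsion D X Y) + torsion D Z (lie_bracket X Y))"
proof -
  have "curvature D X Y Z + curvature D Y Z X + curvature D Z X Y =
    D X (torsion D Y Z) + torsion D X (lie_bracket Y Z) +
    (D Y (torsion D Z X) + torsion D Y (lie_bracket Z X)) +
    (D Z (torsion D X Y) + torsion D Z (lie_bracket X Y)) +
    (lie_bracket X (lie_bracket Y Z) + lie_bracket Y (lie_bracket Z X) + lie_bracket Z (lie_bracket X Y))"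
    using assms
    by (simp add: curvature_def torsion_def closed vector_fields_closed diff_right)
  then show ?thesis unfolding jacobi[OF assms] by simp
qed

end

section \<open>Metric connections on almost Hermitian manifolds\<close>

locale metric_connection = riemannian_manifold A g + connection A D
  for A :: "('m::t2_space, 'e::euclidean_space) atlas" and g and D +
  assumes metric_parallel: "X \<in> vector_fields A \<Longrightarrow> Y \<in> vector_fields A \<Longrightarrow> Z \<in> vector_fields A \<Longrightarrow>
    cov_deriv_metric D g X Y Z = 0"
begin

lemma deriv_G:
  "X \<in> vector_fields A \<Longrightarrow> Y \<in> vector_fields A \<Longrightarrow> Z \<in> vector_fields A \<Longrightarrow>
    deriv_along X (G Y Z) = G (D X Y) Z + G Y (D X Z)"
  using metric_parallel[of X Y Z] by (simp add: cov_deriv_metric_def algebra_simps)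

text \<open>Applying \<open>X Y - Y X - [X, Y] = 0\<close> to the function \<open>g (Z, W)\<close> and expanding by metric compatibility leaves
  exactly the two curvature terms.\<close>

lemma curvature_skew:
  assumes "X \<in> vector_fields A" "Y \<in> vector_fields A" "Z \<in> vector_fields A" "W \<in> vector_fields A"
  shows "G (curvature D X Y Z) W = - G Z (curvature D X Y W)"
proof -
  have "deriv_along X (deriv_along Y (G Z W)) - deriv_along Y (deriv_along X (G Z W))
      = G (D (lie_bracket X Y) Z) W + G Z (D (lie_bracket X Y) W)"
    unfolding deriv_along_lie_bracket[symmetric] using assms by (simp add: deriv_G vector_fields_closed)
  then show ?thesis
    using assms
    by (simp add: curvature_def G_bilinear deriv_G deriv_along_fun smooth_fun_G closed
        vector_fields_closed algebra_simps)
qed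

text \<open>The frame is exchanged in one pair of slots at a time; each time the remaining vector is fixed and
  the trace is that of a bilinear tensor.\<close>

lemma scalar_frame_independent:
  assumes e: "orthonormal_frame_at A g p e" and f: "orthonormal_frame_at A g p f"
  shows "(\<Sum>i<DIM('e). \<Sum>k<DIM('e). G (curvature D (e i) (e k) (e k)) (e i) p)
       = (\<Sum>i<DIM('e). \<Sum>k<DIM('e). G (curvature D (f i) (f k) (f k)) (f i) p)"
proof -
  let ?n = "DIM('e)"
  note s = tensorial_at_def curvature_add_1 curvature_add_2 curvature_add_3 curvature_scale_1
    curvature_scale_2 curvature_scale_3 G_bilinear curvature_closed vector_fields_closed
  have 1: "(\<Sum>i<?n. G (curvature D (e i) Y Y) (e i) p) = (\<Sum>i<?n. G (curvature D (f i) Y Y) (f i) p)"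
    if "Y \<in> vector_fields A" for Y
    by (rule trace_frame_independent[OF _ _ f e, of "\<lambda>X X'. G (curvature D X Y Y) X' p"])
      (use that in \<open>simp_all add: s\<close>)
  have 2: "(\<Sum>k<?n. G (curvature D X (e k) (e k)) X p) = (\<Sum>k<?n. G (curvature D X (f k) (f k)) X p)"
    if "X \<in> vector_fields A" for X
    by (rule trace_frame_independent[OF _ _ f e, of "\<lambda>Y Y'. G (curvature D X Y Y') X p"])
      (use that in \<open>simp_all add: s\<close>)
  have "(\<Sum>i<?n. \<Sum>k<?n. G (curvature D (e i) (e k) (e k)) (e i) p)
      = (\<Sum>k<?n. \<Sum>i<?n. G (curvature D (e i) (e k) (e k)) (e i) p)" by (rule sum.swap)
  also have "\<dots> = (\<Sum>k<?n. \<Sum>i<?n. G (curvature D (f i) (e k) (e k)) (f i) p)"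
    by (intro sum.cong refl 1 frame_field[OF e]) simp
  also have "\<dots> = (\<Sum>i<?n. \<Sum>k<?n. G (curvature D (f i) (e k) (e k)) (f i) p)" by (rule sum.swap)
  also have "\<dots> = (\<Sum>i<?n. \<Sum>k<?n. G (curvature D (f i) (f k) (f k)) (f i) p)"
    by (intro sum.cong refl 2 frame_field[OF f]) simp
  finally show ?thesis .
qed

end

context almost_hermitian_manifold
begin

lemma j_add:
  assumes "X \<in> vector_fields A" "Y \<in> vector_fields A"
  shows "j (X + Y) = j X + j Y"
proof
  show "j (X + Y) p = (j X + j Y) p" for p
    using J_add[OF field_tangent[OF assms(1)] field_tangent[OF assms(2)], of p]
    by (simp only: endo_app_def plus_fun_apply)
qed

lemma j_scale:
  assumes "X \<in> vector_fields A"
  shows "j (scale_field h X) = scale_field h (j X)"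
proof
  show "j (scale_field h X) p = scale_field h (j X) p" for p
    using J_scale[OF field_tangent[OF assms], of p "h p"]
    by (simp only: endo_app_def scale_field_apply)
qed

lemma j_j:
  assumes "X \<in> vector_fields A"
  shows "j (j X) = - X"
proof
  show "j (j X) p = (- X) p" for p
    using J_J[OF field_tangent[OF assms], of p] by (simp only: endo_app_def uminus_apply)
qed

lemma j_minus: "X \<in> vector_fields A \<Longrightarrow> j (- X) = - j X"
  by (simp only: field_minus_eq j_scale)

lemma j_diff: "X \<in> vector_fields A \<Longrightarrow> Y \<in> vector_fields A \<Longrightarrow> j (X - Y) = j X - j Y"
  using j_add[of X "- Y"] by (simp add: vector_fields_minus j_minus)

lemma j_zero: "j 0 = 0"
  using j_diff[of 0 0] vector_fields_zero by simp

text \<open>The simplifier collects \<open>X + X\<close> into \<open>2 * X\<close>, a product of functions that is not of the form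
  \<open>scale_field h X\<close>; these rules let it pass through.\<close>

lemma double:
  assumes "X \<in> vector_fields A"
  shows vector_fields_double: "2 * X \<in> vector_fields A"
    and j_double: "j (2 * X) = 2 * j X"
    and G_double_left: "Y \<in> vector_fields A \<Longrightarrow> G (2 * X) Y = 2 * G X Y"
    and G_double_right: "Y \<in> vector_fields A \<Longrightarrow> G Y (2 * X) = 2 * G Y X"
  unfolding mult_2 by (intro vector_fields_add j_add G_add_left G_add_right assms; assumption)+

lemmas j_simps = j_add j_diff j_minus j_scale j_j j_zero j_double

lemma G_j_j: "X \<in> vector_fields A \<Longrightarrow> Y \<in> vector_fields A \<Longrightarrow> G (j X) (j Y) = G X Y"
  by (auto simp: metric_app_def endo_app_def J_orthogonal field_tangent)

lemma G_j_left: "X \<in> vector_fields A \<Longrightarrow> Y \<in> vector_fields A \<Longrightarrow> G (j X) Y = - G X (j Y)"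
  by (auto simp: metric_app_def endo_app_def J_skew field_tangent)

lemma orthonormal_frame_j:
  assumes "orthonormal_frame_at A g p e"
  shows "orthonormal_frame_at A g p (\<lambda>i. j (e i))"
proof -
  obtain U where U: "open U" "p \<in> U" "orthonormal_frame_on A g U e"
    using assms by (auto simp: orthonormal_frame_at_def)
  have "g q (j (e i) q) (j (e k) q) = g q (e i q) (e k q)"
    if "i < DIM('e)" "k < DIM('e)" for q i k
    using U(3) that J_orthogonal[OF field_tangent field_tangent, of "e i" "e k" q]
    by (simp add: orthonormal_frame_on_def endo_app_def)
  then have "orthonormal_frame_on A g U (\<lambda>i. j (e i))"
    using U(3) vector_fields_j by (simp add: orthonormal_frame_on_def)
  then show ?thesis using U by (auto simp: orthonormal_frame_at_def)
qed

end

section \<open>The Chern connection of a nearly Kaehler structure\<close>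

lemma field_eq_minus_self: "X = - X \<Longrightarrow> X = (0 :: 'm vfield)"
  by (simp add: fun_eq_iff)

text \<open>The Levi-Civita connection \<open>D\<close> and the Chern connection \<open>N\<close> as two instances of the theory of metric
  connections.\<close>

locale nearly_kaehler_with_chern = almost_hermitian_manifold A g J
    + D: metric_connection A g D + N: metric_connection A g N
  for A :: "('m::t2_space, 'e::euclidean_space) atlas" and g J D N +
  assumes D_torsion_free: "X \<in> vector_fields A \<Longrightarrow> Y \<in> vector_fields A \<Longrightarrow> torsion D X Y = 0"
    and nearly_kaehler: "X \<in> vector_fields A \<Longrightarrow> Y \<in> vector_fields A \<Longrightarrow>
      cov_deriv_endo D J X Y + cov_deriv_endo D J Y X = 0"
    and N_parallel_J: "X \<in> vector_fields A \<Longrightarrow> Y \<in> vector_fields A \<Longrightarrow> cov_deriv_endo N J X Y = 0"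
    and N_torsion_J: "X \<in> vector_fields A \<Longrightarrow> Y \<in> vector_fields A \<Longrightarrow>
      torsion N (j X) (j Y) = - torsion N X Y"
begin

definition C :: "'m vfield \<Rightarrow> 'm vfield \<Rightarrow> 'm vfield" where
  "C X Y = N X Y - D X Y"

lemma C_closed: "X \<in> vector_fields A \<Longrightarrow> Y \<in> vector_fields A \<Longrightarrow> C X Y \<in> vector_fields A"
  by (simp add: C_def D.closed N.closed vector_fields_closed)

lemmas field_rules = vector_fields_closed vector_fields_double G_double_left G_double_right vector_fields_j D.closed N.closed C_closed

lemma N_eq: "N X Y = D X Y + C X Y"
  by (simp add: C_def)

lemma bracket_D: "X \<in> vector_fields A \<Longrightarrow> Y \<in> vector_fields A \<Longrightarrow> lie_bracket X Y = D X Y - D Y X"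
  using D_torsion_free[of X Y] by (simp add: torsion_def)

lemma N_j: "X \<in> vector_fields A \<Longrightarrow> Y \<in> vector_fields A \<Longrightarrow> N X (j Y) = j (N X Y)"
  using N_parallel_J[of X Y] by (simp add: cov_deriv_endo_def)

lemma torsion_N: "X \<in> vector_fields A \<Longrightarrow> Y \<in> vector_fields A \<Longrightarrow> torsion N X Y = C X Y - C Y X"
  by (simp add: torsion_def bracket_D C_def)

lemma C_bilinear:
  assumes "X \<in> vector_fields A" "Y \<in> vector_fields A"
  shows C_add_left: "Z \<in> vector_fields A \<Longrightarrow> C (X + Y) Z = C X Z + C Y Z"
    and C_add_right: "Z \<in> vector_fields A \<Longrightarrow> C Z (X + Y) = C Z X + C Z Y"
    and C_diff_left: "Z \<in> vector_fields A \<Longrightarrow> C (X - Y) Z = C X Z - C Y Z"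
    and C_diff_right: "Z \<in> vector_fields A \<Longrightarrow> C Z (X - Y) = C Z X - C Z Y"
    and C_minus_left: "C (- X) Y = - C X Y"
    and C_minus_right: "C X (- Y) = - C X Y"
    and C_scale_left: "smooth_fun A h \<Longrightarrow> C (scale_field h X) Y = scale_field h (C X Y)"
    and C_scale_right: "smooth_fun A h \<Longrightarrow> C X (scale_field h Y) = scale_field h (C X Y)"
  using assms
  by (simp_all add: C_def D.add_left D.add_right D.diff_left D.diff_right D.minus_left D.minus_right
      D.scale_left D.leibniz N.add_left N.add_right N.diff_left N.diff_right N.minus_left
      N.minus_right N.scale_left N.leibniz) (simp_all add: fun_eq_iff algebra_simps)

lemma G_C:
  assumes "X \<in> vector_fields A" "Y \<in> vector_fields A" "Z \<in> vector_fields A"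
  shows "G (C X Y) Z = - G Y (C X Z)"
  using D.deriv_G[OF assms] N.deriv_G[OF assms] assms
  by (simp add: C_def G_bilinear field_rules algebra_simps)

lemma cov_deriv_J:
  assumes "X \<in> vector_fields A" "Y \<in> vector_fields A"
  shows "cov_deriv_endo D J X Y = j (C X Y) - C X (j Y)"
  using N_j[OF assms] assms by (simp add: cov_deriv_endo_def C_def j_simps field_rules)

text \<open>Twice the parts of \<open>C\<^sub>X\<close> that commute and anticommute with \<open>J\<close>. The antilinear part is \<open>- J (D\<^sub>X J)\<close> and is
  therefore skew in \<open>X\<close> and \<open>Y\<close> by the nearly Kaehler condition; the linear part is the one that has to be shown to vanish.\<close>

definition C_linear :: "'m vfield \<Rightarrow> 'm vfield \<Rightarrow> 'm vfield" where
  "C_linear X Y = C X Y - j (C X (j Y))"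

definition C_antilinear :: "'m vfield \<Rightarrow> 'm vfield \<Rightarrow> 'm vfield" where
  "C_antilinear X Y = C X Y + j (C X (j Y))"

lemma C_parts_closed:
  assumes "X \<in> vector_fields A" "Y \<in> vector_fields A"
  shows "C_linear X Y \<in> vector_fields A" "C_antilinear X Y \<in> vector_fields A"
  using assms by (simp_all add: C_linear_def C_antilinear_def field_rules)

lemma C_parts_j:
  assumes "X \<in> vector_fields A" "Y \<in> vector_fields A"
  shows "C_linear X (j Y) = j (C_linear X Y)" "C_antilinear X (j Y) = - j (C_antilinear X Y)"
  using assms by (simp_all add: C_linear_def C_antilinear_def field_rules j_simps C_minus_right)

lemma C_linear_minus:
  assumes "X \<in> vector_fields A" "Y \<in> vector_fields A"
  shows "C_linear (- X) Y = - C_linear X Y"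
  using assms by (simp add: C_linear_def field_rules j_simps C_minus_left)

lemma C_antilinear_anticommute:
  assumes "X \<in> vector_fields A" "Y \<in> vector_fields A"
  shows "C_antilinear Y X = - C_antilinear X Y"
proof -
  have P: "cov_deriv_endo D J X Y = j (C_antilinear X Y)"
    if "X \<in> vector_fields A" "Y \<in> vector_fields A" for X Y
    using that by (simp add: cov_deriv_J C_antilinear_def field_rules j_simps)
  have "j (j (C_antilinear X Y) + j (C_antilinear Y X)) = 0"
    using nearly_kaehler[OF assms] assms by (simp add: P j_zero)
  then have "- C_antilinear X Y - C_antilinear Y X = 0"
    using assms by (simp add: j_simps field_rules C_parts_closed)
  then show ?thesis by (metis eq_iff_diff_eq_0)
qed

text \<open>This is the uniqueness of the Chern connection. The antilinear part already has torsion of the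
  type required of \<open>N\<close>, so the linear part \<open>L\<close> has it as well. Then \<open>F X Y = L\<^sub>X Y + J L\<^sub>J\<^sub>X Y\<close> is symmetric,
  complex linear in \<open>Y\<close> and antilinear in \<open>X\<close>, hence zero; so \<open>L\<close> is complex linear in \<open>X\<close> too, which is not
  compatible with the skewness of \<open>L\<^sub>X\<close> and \<open>L\<^sub>J\<^sub>X\<close> unless \<open>L\<close> is zero.\<close>

lemma C_linear_eq_0:
  assumes X: "X \<in> vector_fields A" and Y: "Y \<in> vector_fields A"
  shows "C_linear X Y = 0"
proof -
  note closure_rules = field_rules C_parts_closed
  have sum: "C_linear X Y + C_antilinear X Y = C X Y + C X Y" for X Y
    by (simp add: C_linear_def C_antilinear_def)
  have tors: "C_linear (j X) (j Y) - C_linear (j Y) (j X) = - (C_linear X Y - C_linear Y X)"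
    if X: "X \<in> vector_fields A" and Y: "Y \<in> vector_fields A" for X Y
  proof -
    have P: "C_antilinear (j X) (j Y) = - C_antilinear X Y"
      if "X \<in> vector_fields A" "Y \<in> vector_fields A" for X Y
    proof -
      have "C_antilinear (j X) (j Y) = j (C_antilinear Y (j X))"
        using that C_antilinear_anticommute[of Y "j X"] by (simp add: C_parts_j closure_rules j_simps)
      also have "\<dots> = - C_antilinear X Y"
        using that C_antilinear_anticommute[of X Y] by (simp add: C_parts_j closure_rules j_simps)
      finally show ?thesis .
    qed
    have "C (j X) (j Y) - C (j Y) (j X) = - (C X Y - C Y X)"
      using N_torsion_J[OF X Y] X Y by (simp add: torsion_N field_rules)
    moreover have "C_linear (j X) (j Y) = C (j X) (j Y) + C (j X) (j Y) + C_antilinear X Y"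
      "C_linear (j Y) (j X) = C (j Y) (j X) + C (j Y) (j X) + C_antilinear Y X"
      "C_linear X Y = C X Y + C X Y - C_antilinear X Y"
      "C_linear Y X = C Y X + C Y X - C_antilinear Y X"
      using sum[of "j X" "j Y"] sum[of "j Y" "j X"] sum[of X Y] sum[of Y X] P[OF X Y] P[OF Y X]
      by (simp_all add: algebra_simps)
    ultimately have "C_linear (j X) (j Y) - C_linear (j Y) (j X)
        = - (C X Y - C Y X) + - (C X Y - C Y X) + (C_antilinear X Y - C_antilinear Y X)"
      by (metis (no_types, opaque_lifting) add_diff_add)
    also have "\<dots> = - (C_linear X Y - C_linear Y X)"
      by (simp add: C_linear_def C_antilinear_def algebra_simps)
    finally show ?thesis .
  qed
  define F where "F X Y = C_linear X Y + j (C_linear (j X) Y)" for X Y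
  have F_closed: "F X Y \<in> vector_fields A"
    if "X \<in> vector_fields A" "Y \<in> vector_fields A" for X Y
    using that by (simp add: F_def closure_rules)
  have F_sym: "F X Y = F Y X" if "X \<in> vector_fields A" "Y \<in> vector_fields A" for X Y
    using tors[OF that] that by (simp add: F_def C_parts_j closure_rules algebra_simps)
  have F_right: "F X (j Y) = j (F X Y)" if "X \<in> vector_fields A" "Y \<in> vector_fields A" for X Y
    using that by (simp add: F_def C_parts_j closure_rules j_simps)
  have F_left: "F (j X) Y = - j (F X Y)" if "X \<in> vector_fields A" "Y \<in> vector_fields A" for X Y
    using that by (simp add: F_def C_linear_minus closure_rules j_simps)
  have F0: "F X Y = 0" if XY: "X \<in> vector_fields A" "Y \<in> vector_fields A" for X Y
  proof -
    have "j (F X Y) = - j (F X Y)"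
      using F_left[OF XY] F_right[OF XY(2,1)] F_sym[OF XY] F_sym[of "j X" Y] XY by (simp add: field_rules)
    then have "j (F X Y) = 0" by (rule field_eq_minus_self)
    then have "j (j (F X Y)) = 0" by (simp add: j_zero)
    then show ?thesis using F_closed[OF XY] by (simp add: j_simps)
  qed
  have left: "C_linear (j X) Y = j (C_linear X Y)" if XY: "X \<in> vector_fields A" "Y \<in> vector_fields A" for X Y
  proof -
    have "j (F X Y) = 0" using F0[OF XY] by (simp add: j_zero)
    then show ?thesis using XY by (simp add: F_def closure_rules j_simps)
  qed
  have skew: "G (C_linear X Y) Z = - G Y (C_linear X Z)"
    if "X \<in> vector_fields A" "Y \<in> vector_fields A" "Z \<in> vector_fields A" for X Y Z
    using that by (simp add: C_linear_def field_rules G_bilinear G_C G_j_left)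
  have "C_linear (j X) Y = 0" if XY: "X \<in> vector_fields A" "Y \<in> vector_fields A" for X Y
  proof (rule field_eq_0I)
    fix Z assume Z: "Z \<in> vector_fields A"
    have "G (C_linear (j X) Y) Z = - G Y (j (C_linear X Z))"
      using skew[OF vector_fields_j[OF XY(1)] XY(2) Z] left[OF XY(1) Z] by simp
    also have "\<dots> = G (j Y) (C_linear X Z)" using XY Z by (simp add: G_j_left closure_rules)
    also have "\<dots> = - G (C_linear X (j Y)) Z" using XY Z by (simp add: skew field_rules)
    also have "\<dots> = - G (C_linear (j X) Y) Z" using XY Z by (simp add: C_parts_j left)
    finally show "G (C_linear (j X) Y) Z = 0" by (simp add: fun_eq_iff)
  qed (use XY closure_rules in simp)
  from this[OF vector_fields_j[OF X] Y] show ?thesis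
    using X Y by (simp add: C_linear_minus j_simps)
qed

lemma C_j_right:
  assumes "X \<in> vector_fields A" "Y \<in> vector_fields A"
  shows "C X (j Y) = - j (C X Y)"
proof -
  have "j (C X Y - j (C X (j Y))) = 0"
    using C_linear_eq_0[OF assms] by (simp add: C_linear_def j_zero)
  then have "j (C X Y) + C X (j Y) = 0" using assms by (simp add: j_simps field_rules)
  then show ?thesis by (metis add.commute eq_neg_iff_add_eq_0)
qed

lemma C_anticommute:
  assumes "X \<in> vector_fields A" "Y \<in> vector_fields A"
  shows "C Y X = - C X Y"
proof -
  have "C_antilinear X Y = C X Y + C X Y" if "X \<in> vector_fields A" "Y \<in> vector_fields A" for X Y
    using that by (simp add: C_antilinear_def C_j_right j_simps field_rules)
  then have "C Y X + C Y X = - (C X Y + C X Y)"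
    using C_antilinear_anticommute[OF assms] assms by simp
  then show ?thesis by (simp add: fun_eq_iff algebra_simps)
qed

lemma C_self: "X \<in> vector_fields A \<Longrightarrow> C X X = 0"
  by (rule field_eq_minus_self) (rule C_anticommute)

lemma C_j_left: "X \<in> vector_fields A \<Longrightarrow> Y \<in> vector_fields A \<Longrightarrow> C (j X) Y = - j (C X Y)"
  using C_anticommute[of "j X" Y] C_anticommute[of X Y] C_j_right[of Y X] by (simp add: field_rules j_simps)

text \<open>Of the terms of \<open>R\<^sup>N - R\<^sup>D\<close> that are linear in \<open>C\<close>, \<open>D\<^sub>Y (C\<^sub>X Y)\<close> and \<open>C (D\<^sub>Y X, Y)\<close> cancel after
  pairing with \<open>X\<close>, and the others vanish or cancel by skewness; only \<open>- C\<^sub>Y C\<^sub>X Y\<close> remains.\<close>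

lemma sectional_curvature_N:
  assumes X: "X \<in> vector_fields A" and Y: "Y \<in> vector_fields A"
  shows "G (curvature N X Y Y) X = G (curvature D X Y Y) X - G (C X Y) (C X Y)"
proof -
  have CC: "C Y (D X Y) = - C (D X Y) Y" by (rule C_anticommute) (use X Y field_rules in auto)
  have "curvature N X Y Y = curvature D X Y Y + C X (D Y Y) - D Y (C X Y) - C Y (C X Y) + C (D Y X) Y"
    using X Y
    by (simp add: curvature_def N_eq field_rules D.add_right C_bilinear C_self D.zero_right bracket_D CC
        algebra_simps)
  moreover have "G (C X (D Y Y)) X = 0"
    using X Y G_C[of X "D Y Y" X] by (simp add: field_rules C_self G_zero)
  moreover have "G (D Y (C X Y)) X = - G (C X Y) (D Y X)"
  proof -
    have "G (C X Y) X = 0" using X Y G_C[of X Y X] by (simp add: C_self G_zero)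
    then have "G (D Y (C X Y)) X + G (C X Y) (D Y X) = 0"
      using X Y D.deriv_G[of Y "C X Y" X] by (simp add: field_rules deriv_along_zero)
    then show ?thesis by (simp add: eq_neg_iff_add_eq_0)
  qed
  moreover have "G (C (D Y X) Y) X = - G (C X Y) (D Y X)"
  proof -
    have "G (C (D Y X) Y) X = G (D Y X) (C Y X)"
      using X Y C_anticommute[of Y "D Y X"] G_C[of Y "D Y X" X] by (simp add: field_rules G_bilinear)
    then show ?thesis
      using X Y C_anticommute[OF X Y] G_sym[of "D Y X" "C X Y"] by (simp add: field_rules G_bilinear)
  qed
  moreover have "G (C Y (C X Y)) X = G (C X Y) (C X Y)"
    using X Y G_C[of Y "C X Y" X] C_anticommute[OF X Y] by (simp add: field_rules G_bilinear)
  ultimately show ?thesis using X Y by (simp add: G_bilinear field_rules D.curvature_closed)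
qed

lemma torsion_N_eq:
  "X \<in> vector_fields A \<Longrightarrow> Y \<in> vector_fields A \<Longrightarrow> torsion N X Y = C X Y + C X Y"
  using C_anticommute[of X Y] by (simp add: torsion_N)

lemma torsion_N_closed:
  "X \<in> vector_fields A \<Longrightarrow> Y \<in> vector_fields A \<Longrightarrow> torsion N X Y \<in> vector_fields A"
  by (simp add: torsion_N_eq field_rules)

lemma torsion_N_self: "X \<in> vector_fields A \<Longrightarrow> torsion N X X = 0"
  by (simp add: torsion_def lie_bracket_def fun_eq_iff)

lemma torsion_N_rules:
  assumes "X \<in> vector_fields A" "Y \<in> vector_fields A"
  shows torsion_N_j_left: "torsion N (j X) Y = - j (torsion N X Y)"
    and torsion_N_j_right: "torsion N X (j Y) = - j (torsion N X Y)"
    and torsion_N_anticommute: "torsion N Y X = - torsion N X Y"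
    and G_torsion_N: "Z \<in> vector_fields A \<Longrightarrow> G (torsion N X Y) Z = - G Y (torsion N X Z)"
    and torsion_N_add: "Z \<in> vector_fields A \<Longrightarrow> torsion N X (Y + Z) = torsion N X Y + torsion N X Z"
    and torsion_N_diff: "Z \<in> vector_fields A \<Longrightarrow> torsion N X (Y - Z) = torsion N X Y - torsion N X Z"
  using assms C_anticommute[OF assms]
  by (simp_all add: torsion_N_eq field_rules C_j_left C_j_right j_simps C_bilinear G_bilinear G_C)

lemma bracket_N:
  "X \<in> vector_fields A \<Longrightarrow> Y \<in> vector_fields A \<Longrightarrow> lie_bracket X Y = N X Y - N Y X - torsion N X Y"
  by (simp add: torsion_def)

lemma curvature_N_j:
  "X \<in> vector_fields A \<Longrightarrow> Y \<in> vector_fields A \<Longrightarrow> Z \<in> vector_fields A \<Longrightarrow>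
    curvature N X Y (j Z) = j (curvature N X Y Z)"
  by (simp add: curvature_def N_j field_rules j_simps)

text \<open>With \<open>t = T (X, Y)\<close>, the functions \<open>g (t, Y)\<close> and \<open>g (t, J Y)\<close> are identically zero, so the derivatives
  of \<open>t\<close> can be moved to \<open>Y\<close>, where they cancel against the torsion of the brackets. Each of the brackets
  \<open>[J X, Y]\<close> and \<open>[Y, X]\<close> leaves one copy of \<open>|t|\<^sup>2\<close>.\<close>

lemma bianchi_defect:
  assumes X: "X \<in> vector_fields A" and Y: "Y \<in> vector_fields A"
  defines "t \<equiv> torsion N X Y"
  shows "G (curvature N X (j X) Y + curvature N (j X) Y X + curvature N Y X (j X)) (j Y)
    = G t t + G t t"
proof -
  note closure_rules = field_rules torsion_N_closed
  have t: "t \<in> vector_fields A" using X Y by (simp add: t_def closure_rules)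
  have T1: "torsion N (j X) Y = - j t" and T2: "torsion N Y X = - t" and T3: "torsion N X (j X) = 0"
    using X Y torsion_N_anticommute[OF X Y]
    by (simp_all add: t_def torsion_N_self torsion_N_j_left torsion_N_j_right j_zero)
  have B1: "lie_bracket (j X) Y = N (j X) Y - j (N Y X) + j t"
    using X Y by (simp add: bracket_N field_rules N_j T1)
  have B2: "lie_bracket Y X = N Y X - N X Y + t"
    using X Y by (simp add: bracket_N T2)
  have S: "curvature N X (j X) Y + curvature N (j X) Y X + curvature N Y X (j X)
    = - j (N X t) - N (j X) t + torsion N X (N (j X) Y) + j (torsion N X (N X Y))
      - (j (torsion N X t) + j (torsion N X t)) + torsion N Y (lie_bracket X (j X))"
  proof -
    have b1: "torsion N X (lie_bracket (j X) Y)
        = torsion N X (N (j X) Y) + j (torsion N X (N Y X)) - j (torsion N X t)"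
      using X Y t by (simp add: B1 closure_rules torsion_N_add torsion_N_diff torsion_N_j_right)
    have b2: "torsion N (j X) (lie_bracket Y X)
        = j (torsion N X (N X Y)) - j (torsion N X (N Y X)) - j (torsion N X t)"
      using X Y t by (simp add: B2 closure_rules torsion_N_add torsion_N_diff torsion_N_j_left)
    have n: "N X (torsion N (j X) Y) = - j (N X t)" "N (j X) (torsion N Y X) = - N (j X) t"
      "N Y (torsion N X (j X)) = 0"
      using X Y t by (simp_all add: T1 T2 T3 N.minus_right N.zero_right N_j field_rules)
    show ?thesis
      unfolding N.first_bianchi[OF X vector_fields_j[OF X] Y] b1 b2 n by (simp add: algebra_simps)
  qed
  have tY: "G t Y = 0" "G t (j Y) = 0"
  proof -
    have "G t Y = - G t Y" using X Y t G_torsion_N[OF X Y Y] G_sym[OF t Y] by (simp add: t_def)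
    then show "G t Y = 0" by (simp add: fun_eq_iff)
    have "G t (j Y) = G Y (j t)"
      using X Y t G_torsion_N[OF X Y, of "j Y"] by (simp add: t_def closure_rules torsion_N_j_right G_bilinear)
    also have "\<dots> = - G t (j Y)"
      using t Y G_j_left[OF t Y] G_sym[of "j t" Y] by (simp add: field_rules)
    finally show "G t (j Y) = 0" by (simp add: fun_eq_iff)
  qed
  have p1: "G (j (N X t)) (j Y) = - G t (N X Y)"
    using N.deriv_G[OF X t Y] X Y t
    by (simp add: tY deriv_along_zero G_j_j field_rules eq_neg_iff_add_eq_0)
  have p2: "G (N (j X) t) (j Y) = - G t (j (N (j X) Y))"
    using N.deriv_G[of "j X" t "j Y"] X Y t
    by (simp add: tY deriv_along_zero N_j field_rules eq_neg_iff_add_eq_0)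
  have p3: "G (torsion N X W) (j Y) = - G t (j W)" if W: "W \<in> vector_fields A" for W
    using X Y W t G_torsion_N[OF X W, of "j Y"] G_j_left[OF W t] G_sym[of t "j W"]
    by (simp add: closure_rules torsion_N_j_right G_bilinear flip: t_def)
  have p4: "G (j (torsion N X W)) (j Y) = - G t W" if W: "W \<in> vector_fields A" for W
    using X Y W t G_torsion_N[OF X W Y] G_sym[OF t W] by (simp add: closure_rules G_j_j flip: t_def)
  have p5: "G (torsion N Y (lie_bracket X (j X))) (j Y) = 0"
    using X Y G_torsion_N[OF Y _, of "lie_bracket X (j X)" "j Y"] torsion_N_self[OF Y]
    by (simp add: field_rules torsion_N_j_right j_zero G_zero)
  show ?thesis
    unfolding S using X Y t by (simp add: G_bilinear closure_rules p1 p2 p3 p4 p5)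
qed

section \<open>Comparison of the scalar curvatures\<close>

text \<open>In the Bianchi identity for \<open>X = e\<^sub>i\<close>, \<open>Y = e\<^sub>k\<close> the third curvature term is already of the form
  \<open>g (R\<^sub>X\<^sub>Y Y, X)\<close>. The second one is brought to it by passing from the frame \<open>(e\<^sub>i)\<close> to \<open>(J e\<^sub>i)\<close> in the sum
  over \<open>i\<close>.\<close>

lemma chern_trace:
  assumes e: "orthonormal_frame_at A g p e"
  shows "(\<Sum>i<DIM('e). \<Sum>k<DIM('e). G (curvature N (e i) (j (e i)) (e k)) (j (e k)) p)
    = 8 * (\<Sum>i<DIM('e). \<Sum>k<DIM('e). G (C (e i) (e k)) (C (e i) (e k)) p)
      - 2 * (\<Sum>i<DIM('e). \<Sum>k<DIM('e). G (curvature N (e i) (e k) (e k)) (e i) p)"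
proof -
  let ?n = "DIM('e)"
  note ei = frame_field[OF e]
  note s = tensorial_at_def N.curvature_add_1 N.curvature_add_2 N.curvature_add_3 N.curvature_scale_1
    N.curvature_scale_2 N.curvature_scale_3 G_bilinear N.curvature_closed field_rules j_simps
  have R1: "G (curvature N X Y X) Y = - G (curvature N X Y Y) X"
    if "X \<in> vector_fields A" "Y \<in> vector_fields A" for X Y
    using that N.curvature_skew[of X Y X Y] G_sym[of X "curvature N X Y Y"]
    by (simp add: N.curvature_closed)
  have R2: "G (curvature N Y X (j X)) (j Y) = G (curvature N X Y Y) X"
    if "X \<in> vector_fields A" "Y \<in> vector_fields A" for X Y
    using that N.curvature_anticommute[of X Y X] R1[OF that]
    by (simp add: curvature_N_j G_j_j N.curvature_closed G_bilinear field_rules j_simps)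
  have R3: "(\<Sum>i<?n. G (curvature N (j (e i)) Y (e i)) (j Y) p) = (\<Sum>i<?n. G (curvature N (e i) Y Y) (e i) p)"
    if Y: "Y \<in> vector_fields A" for Y
  proof -
    have "G (curvature N (j (j X)) Y (j X)) (j Y) = G (curvature N X Y Y) X"
      if "X \<in> vector_fields A" for X
    proof -
      have "curvature N (- X) Y (j X) = - curvature N X Y (j X)"
        using that Y N.curvature_scale_1[of "\<lambda>_. - 1" X Y "j X"]
        by (simp add: field_rules smooth_fun_const flip: field_minus_eq)
      then show ?thesis
        using that Y R1[of X Y] by (simp add: j_simps curvature_N_j G_j_j N.curvature_closed field_rules G_bilinear)
    qed
    then have "(\<Sum>i<?n. G (curvature N (e i) Y Y) (e i) p)
        = (\<Sum>i<?n. G (curvature N (j (j (e i))) Y (j (e i))) (j Y) p)"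
      using ei by simp
    also have "\<dots> = (\<Sum>i<?n. G (curvature N (j (e i)) Y (e i)) (j Y) p)"
      by (rule trace_frame_independent[OF _ _ e orthonormal_frame_j[OF e],
            of "\<lambda>X X'. G (curvature N (j X) Y X') (j Y) p"])
        (use Y in \<open>simp_all add: s\<close>)
    finally show ?thesis by simp
  qed
  have "G (curvature N X (j X) Y) (j Y) p = 8 * G (C X Y) (C X Y) p
      - G (curvature N (j X) Y X) (j Y) p - G (curvature N X Y Y) X p"
    if "X \<in> vector_fields A" "Y \<in> vector_fields A" for X Y
    using fun_cong[OF bianchi_defect[OF that], of p] that
    by (simp add: torsion_N_eq R2 G_bilinear field_rules N.curvature_closed)
  then have "(\<Sum>i<?n. \<Sum>k<?n. G (curvature N (e i) (j (e i)) (e k)) (j (e k)) p)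
      = (\<Sum>i<?n. \<Sum>k<?n. 8 * G (C (e i) (e k)) (C (e i) (e k)) p
        - G (curvature N (j (e i)) (e k) (e i)) (j (e k)) p - G (curvature N (e i) (e k) (e k)) (e i) p)"
    using ei by simp
  then have "(\<Sum>i<?n. \<Sum>k<?n. G (curvature N (e i) (j (e i)) (e k)) (j (e k)) p)
      = 8 * (\<Sum>i<?n. \<Sum>k<?n. G (C (e i) (e k)) (C (e i) (e k)) p)
        - (\<Sum>i<?n. \<Sum>k<?n. G (curvature N (j (e i)) (e k) (e i)) (j (e k)) p)
        - (\<Sum>i<?n. \<Sum>k<?n. G (curvature N (e i) (e k) (e k)) (e i) p)"
    by (simp add: sum_subtractf sum_distrib_left)
  moreover have "(\<Sum>i<?n. \<Sum>k<?n. G (curvature N (j (e i)) (e k) (e i)) (j (e k)) p)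
      = (\<Sum>i<?n. \<Sum>k<?n. G (curvature N (e i) (e k) (e k)) (e i) p)"
  proof -
    have "(\<Sum>i<?n. \<Sum>k<?n. G (curvature N (j (e i)) (e k) (e i)) (j (e k)) p)
        = (\<Sum>k<?n. \<Sum>i<?n. G (curvature N (j (e i)) (e k) (e i)) (j (e k)) p)"
      by (rule sum.swap)
    also have "\<dots> = (\<Sum>k<?n. \<Sum>i<?n. G (curvature N (e i) (e k) (e k)) (e i) p)"
      using R3[OF ei] by simp
    also have "\<dots> = (\<Sum>i<?n. \<Sum>k<?n. G (curvature N (e i) (e k) (e k)) (e i) p)"
      by (rule sum.swap)
    finally show ?thesis .
  qed
  ultimately show ?thesis by simp
qed

lemma double_sum_nonneg_eq_0:
  fixes c :: "nat \<Rightarrow> nat \<Rightarrow> real"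
  assumes "\<And>i k. i < n \<Longrightarrow> k < n \<Longrightarrow> 0 \<le> c i k" "(\<Sum>i<n. \<Sum>k<n. c i k) = 0" "i < n" "k < n"
  shows "c i k = 0"
proof -
  have row: "0 \<le> (\<Sum>k<n. c i k)" if "i < n" for i
    by (rule sum_nonneg) (simp add: assms(1) that)
  have z: "(\<Sum>k<n. c i k) = 0"
  proof (rule sum_nonneg_0[of "{..<n}" "\<lambda>i. \<Sum>k<n. c i k" i])
    show "0 \<le> (\<Sum>k<n. c i k)" if "i \<in> {..<n}" for i using row that by simp
  qed (use assms(2,3) in auto)
  show ?thesis
  proof (rule sum_nonneg_0[of "{..<n}" "c i" k])
    show "0 \<le> c i k" if "k \<in> {..<n}" for k using assms(1)[OF assms(3)] that by simp
  qed (use z assms(4) in auto)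
qed

text \<open>The frame is the one that the definitions of the scalar curvatures choose, so that these can be compared
  with the energy directly.\<close>

definition energy :: "'m \<Rightarrow> real" where
  "energy p = (let e = (SOME e. adapted_frame_at A J g p e) in
    \<Sum>i<DIM('e). \<Sum>k<DIM('e). G (C (e i) (e k)) (C (e i) (e k)) p)"

lemma some_adapted_frame: "orthonormal_frame_at A g p (SOME e. adapted_frame_at A J g p e)"
  using ex_adapted_frame adapted_imp_orthonormal_frame by (metis someI_ex)

lemma some_orthonormal_frame: "orthonormal_frame_at A g p (SOME e. orthonormal_frame_at A g p e)"
  using someI[of "orthonormal_frame_at A g p", OF some_adapted_frame] .

lemma third_eq_riemannian: "2 * third_scalar A J g N p = riemannian_scalar A g D p - energy p"
proof -
  define e where "e = (SOME e. adapted_frame_at A J g p e)"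
  have e: "orthonormal_frame_at A g p e" unfolding e_def by (rule some_adapted_frame)
  have "2 * third_scalar A J g N p
      = (\<Sum>i<DIM('e). \<Sum>k<DIM('e). G (curvature N (e i) (e k) (e k)) (e i) p)"
    by (simp add: third_scalar_def Let_def e_def)
  also have "\<dots> = (\<Sum>i<DIM('e). \<Sum>k<DIM('e). G (curvature D (e i) (e k) (e k)) (e i) p) - energy p"
    using frame_field[OF e]
    by (simp add: sectional_curvature_N sum_subtractf energy_def Let_def flip: e_def)
  also have "\<dots> = riemannian_scalar A g D p - energy p"
    using D.scalar_frame_independent[OF e some_orthonormal_frame]
    by (simp add: riemannian_scalar_def Let_def)
  finally show ?thesis .
qed

lemma hermitian_eq_third: "hermitian_scalar A J g N p = 2 * third_scalar A J g N p - 4 * energy p"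
proof -
  define e where "e = (SOME e. adapted_frame_at A J g p e)"
  define Q where "Q = (\<Sum>i<DIM('e). \<Sum>k<DIM('e). G (curvature N (e i) (j (e i)) (e k)) (j (e k)) p)"
  define K where "K = (\<Sum>i<DIM('e). \<Sum>k<DIM('e). G (curvature N (e i) (e k) (e k)) (e i) p)"
  have "Q = 8 * energy p - 2 * K"
    unfolding Q_def K_def energy_def Let_def e_def by (rule chern_trace[OF some_adapted_frame])
  moreover have "hermitian_scalar A J g N p = - (1/2) * Q"
    by (simp add: hermitian_scalar_def chern_scalar_def Let_def Q_def e_def)
  moreover have "2 * third_scalar A J g N p = K"
    by (simp add: third_scalar_def Let_def K_def e_def)
  ultimately show ?thesis by linarith
qed

lemma energy_nonneg: "energy p \<ge> 0"
  using frame_field[OF some_adapted_frame[of p]]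
  by (auto simp: energy_def Let_def intro!: sum_nonneg G_nonneg C_closed)

text \<open>A sum of squares that vanishes has vanishing terms, and \<open>C\<close> is tensorial, so its values on a frame
  determine it at \<open>p\<close>.\<close>

lemma energy_eq_0_imp:
  assumes "energy p = 0" and X: "X \<in> vector_fields A" and Y: "Y \<in> vector_fields A"
  shows "C X Y p = 0"
proof -
  define e where "e = (SOME e. adapted_frame_at A J g p e)"
  have e: "orthonormal_frame_at A g p e" unfolding e_def by (rule some_adapted_frame)
  note ei = frame_field[OF e]
  let ?n = "DIM('e)" and ?c = "\<lambda>i k. G (C (e i) (e k)) (C (e i) (e k)) p"
  have nonneg: "0 \<le> ?c i k" if "i < ?n" "k < ?n" for i k
    using that by (simp add: G_nonneg C_closed ei)
  have "(\<Sum>i<?n. \<Sum>k<?n. ?c i k) = 0"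
    using assms(1) by (simp add: energy_def Let_def e_def)
  then have "?c i k = 0" if "i < ?n" "k < ?n" for i k
    using double_sum_nonneg_eq_0[of ?n ?c i k] nonneg that by blast
  then have C0: "C (e i) (e k) p = 0" if "i < ?n" "k < ?n" for i k
    using that G_eq_0_iff[OF C_closed[OF ei[OF that(1)] ei[OF that(2)]], of p] by simp
  have G0: "G (C (e i) (e k)) Z p = 0" if "i < ?n" "k < ?n" "Z \<in> vector_fields A" for i k Z
    using C0[OF that(1,2)] metric_zero_left[OF field_tangent[OF that(3)], of p]
    by (simp add: metric_app_def)
  have "G (C X Y) Z p = 0" if Z: "Z \<in> vector_fields A" for Z
  proof -
    have t1: "tensorial_at p (\<lambda>X. G (C X Y) Z p)"
      using Y Z by (simp add: tensorial_at_def C_bilinear G_bilinear field_rules)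
    have t2: "tensorial_at p (\<lambda>Y. G (C (e i) Y) Z p)" if "i < DIM('e)" for i
      using ei[OF that] Z by (simp add: tensorial_at_def C_bilinear G_bilinear field_rules)
    have "G (C (e i) Y) Z p = 0" if "i < DIM('e)" for i
      using tensorial_expansion[OF t2[OF that] e Y] G0 that Z by simp
    then show ?thesis using tensorial_expansion[OF t1 e X] by simp
  qed
  then show ?thesis using G_eq_0_iff[OF C_closed[OF X Y], of p] C_closed[OF X Y] by simp
qed

text \<open>In terms of \<open>N\<close> the derivatives cancel, as \<open>J\<close> is parallel, and the four brackets contribute one copy of
  the torsion \<open>2 C\<close> each.\<close>

lemma nijenhuis_eq:
  assumes "X \<in> vector_fields A" "Y \<in> vector_fields A"
  shows "nijenhuis J X Y = scale_field (\<lambda>_. 8) (C X Y)"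
proof -
  have "nijenhuis J X Y = torsion N X Y + torsion N X Y + torsion N X Y + torsion N X Y"
    using assms
    by (simp add: nijenhuis_def bracket_N field_rules N_j j_simps torsion_N_closed torsion_N_j_left
        torsion_N_j_right algebra_simps)
  then show ?thesis using assms by (simp add: torsion_N_eq fun_eq_iff)
qed

lemma exterior_deriv_fundamental_form:
  assumes X: "X \<in> vector_fields A" and Y: "Y \<in> vector_fields A" and Z: "Z \<in> vector_fields A"
    and C0: "\<And>X Y. X \<in> vector_fields A \<Longrightarrow> Y \<in> vector_fields A \<Longrightarrow> C X Y = 0"
  shows "exterior_deriv2 (fundamental_form J g) X Y Z = 0"
proof -
  have br: "lie_bracket X Y = N X Y - N Y X"
    if "X \<in> vector_fields A" "Y \<in> vector_fields A" for X Y
    using that C0 by (simp add: bracket_N torsion_N_eq)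
  have anti: "G (j V) W = - G (j W) V" if "V \<in> vector_fields A" "W \<in> vector_fields A" for V W
    using that G_j_left[of V W] G_sym[of V "j W"] by (simp add: field_rules)
  show ?thesis
    using X Y Z anti[of Y "N X Z"] anti[of X "N Y Z"] anti[of X "N Z Y"]
    by (simp add: exterior_deriv2_def fundamental_form_def N.deriv_G N_j br field_rules j_simps G_bilinear)
qed

text \<open>As the Nijenhuis tensor is \<open>8 C\<close>, integrability forces \<open>C = 0\<close>; conversely, if \<open>C = 0\<close>, then
  \<open>N\<close> is torsion-free and \<open>J\<close> is parallel, which gives integrability and a closed fundamental form.\<close>

lemma kaehler_iff_energy: "kaehler A J g \<longleftrightarrow> (\<forall>p. energy p = 0)"
proof
  assume "kaehler A J g"
  then have "scale_field (\<lambda>_. 8) (C X Y) = 0" if "X \<in> vector_fields A" "Y \<in> vector_fields A" for X Y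
    using that nijenhuis_eq by (metis kaehler_def)
  then have "C X Y = 0" if "X \<in> vector_fields A" "Y \<in> vector_fields A" for X Y
    using that by (simp add: fun_eq_iff)
  then show "\<forall>p. energy p = 0"
    using frame_field[OF some_adapted_frame]
    by (simp add: energy_def Let_def G_zero vector_fields_zero)
next
  assume "\<forall>p. energy p = 0"
  then have C0: "C X Y = 0" if "X \<in> vector_fields A" "Y \<in> vector_fields A" for X Y
    using energy_eq_0_imp that by (simp add: fun_eq_iff)
  have "almost_hermitian A J g"
    using smooth_atlas almost_complex riemannian_metric J_orthogonal by (simp add: almost_hermitian_def)
  moreover have "nijenhuis J X Y = 0" if "X \<in> vector_fields A" "Y \<in> vector_fields A" for X Y
    using C0[OF that] nijenhuis_eq[OF that] by (simp add: fun_eq_iff)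
  ultimately show "kaehler A J g"
    using exterior_deriv_fundamental_form C0 by (simp add: kaehler_def)
qed

end

theorem corollary3p5:
  fixes A :: "('m::{t2_space, second_countable_topology}, 'e::euclidean_space) atlas"
    and J :: "'m endo" and g :: "'m metric_tensor"
    and D N :: "'m connection"
  assumes "levi_civita A g D"
    and "chern_connection A J g N"
    and "nearly_kaehler A J g D"
  shows "(\<forall>p. hermitian_scalar A J g N p \<le> 2 * third_scalar A J g N p
            \<and> 2 * third_scalar A J g N p \<le> riemannian_scalar A g D p)
       \<and> ((\<forall>p. hermitian_scalar A J g N p = 2 * third_scalar A J g N p) \<longleftrightarrow> kaehler A J g)
       \<and> ((\<forall>p. 2 * third_scalar A J g N p = riemannian_scalar A g D p) \<longleftrightarrow> kaehler A J g)"
proof -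
  have h: "almost_hermitian A J g" using assms(3) by (simp add: nearly_kaehler_def)
  interpret nearly_kaehler_with_chern A g J D N
    by unfold_locales
      (use h assms in \<open>auto simp: almost_hermitian_def levi_civita_def chern_connection_def nearly_kaehler_def\<close>)
  show ?thesis
    by (auto simp: hermitian_eq_third third_eq_riemannian kaehler_iff_energy energy_nonneg)
qed

end
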